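(* Let $R$ be a real closed field and $F$ a formally real extension field of $R$. Let $P_1$ and $P_2$ be orderings of $F$ which induce the same $\mathbb R$-place of $F$, and let $R'_1$ and $R'_2$ be the real closures of $(F,P_1)$ and $(F,P_2)$ respectively. For $i=1,2$ let $\iota'_i:M(R(y))\to M(R'_i(y))$ be the (unique) continuous injective map compatible with restriction, and let $\mathrm{res}_i:M(R'_i(y))\to M(F(y))$ be the restriction map. Then $\mathrm{res}_1\circ\iota'_1=\mathrm{res}_2\circ\iota'_2$.
   Context: For a field $K$, $M(K)$ is the set of $\mathbb R$-places $K\to\mathbb R\cup\{\infty\}$, with topology generated by the subbasis $H'(b)=\{\zeta\in M(K)\mid \infty\ne\zeta(b)>0\}$, $b\in K$. Each ordering of $K$ induces an $\mathbb R$-place of $K$ (its associated place). For a field extension $L|K$, restriction is $\zeta\mapsto\zeta|_K$, and a map $\iota:M(K)\to M(L)$ is compatible with restriction if composing it with restriction gives the identity. $R(y)$, $R'_i(y)$, $F(y)$ are rational function fields in one variable $y$. The statement presupposes that the embeddings $\iota'_i$ exist (this holds iff the value group of $R$ is convex in that of $R'_i$ under the canonical valuations; in that case the embedding is unique since $R'_i$ is real closed). *)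

theory Defs
  imports "HOL-Analysis.Analysis" "HOL-Computational_Algebra.Polynomial"
    "HOL-Computational_Algebra.Fraction_Field"
begin

definition field_hom :: "('k::field \<Rightarrow> 'l::field) \<Rightarrow> bool" where
  "field_hom h \<longleftrightarrow> h 1 = 1 \<and> (\<forall>a b. h (a + b) = h a + h b \<and> h (a * b) = h a * h b)"

definition formally_real :: "'k::field itself \<Rightarrow> bool" where
  "formally_real _ \<longleftrightarrow> (\<forall>xs :: 'k list. (\<Sum>x\<leftarrow>xs. x ^ 2) \<noteq> - 1)"

text \<open>Real closed field (definition as in Basu--Pollack--Roy: an ordered field whose
  positive cone is the set of squares and in which every odd degree polynomial has a root).\<close>
definition real_closed_field :: "'k::field itself \<Rightarrow> bool" where
  "real_closed_field T \<longleftrightarrow> formally_real T \<and>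
     (\<forall>a :: 'k. \<exists>b. a = b ^ 2 \<or> - a = b ^ 2) \<and>
     (\<forall>p :: 'k poly. odd (degree p) \<longrightarrow> (\<exists>x. poly p x = 0))"

definition field_ordering :: "'k::field set \<Rightarrow> bool" where
  "field_ordering P \<longleftrightarrow> (\<forall>a\<in>P. \<forall>b\<in>P. a + b \<in> P \<and> a * b \<in> P) \<and>
     (\<forall>a. a \<in> P \<or> - a \<in> P) \<and> (\<forall>a. a \<in> P \<and> - a \<in> P \<longrightarrow> a = 0)"

text \<open>\<open>j\<close> makes the field \<open>'a\<close> a real closure of the ordered field \<open>(F, P)\<close>:
  \<open>'a\<close> is real closed, algebraic over \<open>j(F)\<close>, and its unique ordering (the squares)
  restricts to \<open>P\<close>.\<close>
definition real_closure_of :: "'f::field set \<Rightarrow> ('f \<Rightarrow> 'a::field) \<Rightarrow> bool" where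
  "real_closure_of P j \<longleftrightarrow> field_hom j \<and> real_closed_field TYPE('a) \<and>
     (\<forall>x :: 'a. \<exists>p :: 'f poly. p \<noteq> 0 \<and> poly (map_poly j p) x = 0) \<and>
     (\<forall>a. a \<in> P \<longleftrightarrow> (\<exists>b. j a = b ^ 2))"

text \<open>An \<open>\<real>\<close>-place \<open>K \<rightarrow> \<real> \<union> {\<infinity>}\<close>; \<open>None\<close> represents \<open>\<infinity>\<close>.
  The finite part \<open>{a. \<zeta> a \<noteq> \<infinity>}\<close> is a subring on which \<open>\<zeta>\<close> is a ring homomorphism to \<open>\<real>\<close>,
  and \<open>\<zeta> a = \<infinity>\<close> iff \<open>\<zeta> (a\<inverse>) = 0\<close> (for \<open>a \<noteq> 0\<close>); i.e. the finite part is a valuation ring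
  with maximal ideal the kernel.\<close>
definition real_place :: "('k::field \<Rightarrow> real option) \<Rightarrow> bool" where
  "real_place \<zeta> \<longleftrightarrow> \<zeta> 1 = Some 1 \<and>
     (\<forall>a b r s. \<zeta> a = Some r \<and> \<zeta> b = Some s \<longrightarrow>
        \<zeta> (a + b) = Some (r + s) \<and> \<zeta> (a * b) = Some (r * s)) \<and>
     (\<forall>a. a \<noteq> 0 \<longrightarrow> (\<zeta> a = None \<longleftrightarrow> \<zeta> (inverse a) = Some 0))"

definition places :: "('k::field \<Rightarrow> real option) set" where
  "places = {\<zeta>. real_place \<zeta>}"

definition Hsub :: "'k::field \<Rightarrow> ('k \<Rightarrow> real option) set" where
  "Hsub b = {\<zeta> \<in> places. \<exists>r. \<zeta> b = Some r \<and> r > 0}"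

definition Mtop :: "('k::field \<Rightarrow> real option) topology" where
  "Mtop = topology_generated_by (range Hsub)"

definition restrict_place :: "('k::field \<Rightarrow> 'l::field) \<Rightarrow> ('l \<Rightarrow> real option) \<Rightarrow> ('k \<Rightarrow> real option)" where
  "restrict_place h \<zeta> = \<zeta> \<circ> h"

definition ordering_place :: "'k::field set \<Rightarrow> 'k \<Rightarrow> real option" where
  "ordering_place P a =
     (if \<exists>n::nat. of_nat n - a \<in> P \<and> of_nat n + a \<in> P
      then Some (Sup {real_of_int m / real n | m n. n > 0 \<and> of_nat n * a - of_int m \<in> P})
      else None)"

text \<open>\<open>K(y)\<close> is modelled as \<open>'k poly fract\<close>. An embedding \<open>h : K \<rightarrow> L\<close> extends to
  \<open>K(y) \<rightarrow> L(y)\<close>, \<open>y \<mapsto> y\<close>, by mapping coefficients.\<close>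
definition rf_map :: "('k::field \<Rightarrow> 'l::field) \<Rightarrow> 'k poly fract \<Rightarrow> 'l poly fract" where
  "rf_map h x = (THE z. \<exists>p q. q \<noteq> 0 \<and> x = Fract p q \<and> z = Fract (map_poly h p) (map_poly h q))"

end

theory Submission
  imports Defs "HOL-Algebra.Algebraic_Closure_Type"
begin

text \<open>
  Composing \<open>\<iota>1\<close> and \<open>\<iota>2\<close> with restriction gives two continuous sections of
  \<open>M(F(y)) \<rightarrow> M(R(y))\<close>, and both take every place to one that extends the place common to
  \<open>P1\<close> and \<open>P2\<close>. As \<open>R\<close> is real closed, the places \<open>y \<mapsto> a\<close> with \<open>a \<in> R\<close> are dense in
  \<open>M(R(y))\<close>: the sign of a polynomial is decided by its linear factors, so finitely many
  inequalities that hold at a place hold on an interval of \<open>R\<close>. Since \<open>M(F(y))\<close> is Hausdorff, it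
  suffices to compare the sections at these places. There continuity determines the value of
  \<open>(y - a)^n * t\<close> for all \<open>n > 0\<close> and \<open>t \<in> F\<close>: it is \<open>0\<close> or \<open>\<infinity>\<close>, never a unit. Hence every
  polynomial in \<open>y - a\<close> is dominated by one of its terms, which determines the place.
\<close>

text \<open>Both restrictions land over the same place of F because elements of P_i are squares in
  R'_i and a real place is nonnegative on squares; so every place of R'_i(y) induces on F the place
  of P_i.

  Real closedness is given only by roots of odd degree polynomials and by square roots up to sign.
  The factorisation into linear and definite quadratic factors therefore has to be derived, by
  Laplace's proof that adjoining a square root of -1 yields roots of all polynomials. Symmetric
  functions of the roots are treated through power sums, with Newton's identities in the place of
  the fundamental theorem on symmetric polynomials.

  A place carries no ordering, while density is a matter of signs. The signs are taken from a
  preordering attached to the place, enlarged until it decides the finitely many elements y - x that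
  matter. Finiteness of a value is no sign condition either; it becomes one by bounding b between
  1/n and n, and these bounds survive specialisation.\<close>

hide_const (open) Polynomials.degree Polynomials.lead_coeff Module.smult up_ring.coeff

section \<open>Field embeddings and their images\<close>

locale field_embedding =
  fixes h :: "'k::field \<Rightarrow> 'l::field"
  assumes hom: "field_hom h"
begin

lemma hom_one [simp]: "h 1 = 1"
  and hom_add [simp]: "h (a + b) = h a + h b"
  and hom_mult [simp]: "h (a * b) = h a * h b"
  using hom by (auto simp: field_hom_def)

lemma hom_zero [simp]: "h 0 = 0"
  using hom_add[of 0 0] by (metis add_cancel_right_left)

lemma hom_uminus [simp]: "h (- a) = - h a"
  using hom_add[of a "- a"] by (simp add: eq_neg_iff_add_eq_0 add.commute del: hom_add)

lemma hom_diff [simp]: "h (a - b) = h a - h b"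
  using hom_add[of a "- b"] by (simp del: hom_add)

lemma hom_eq_0_iff [simp]: "h a = 0 \<longleftrightarrow> a = 0"
proof
  assume "h a = 0"
  then have "h (a * inverse a) = 0" by simp
  then show "a = 0" by (metis hom_one right_inverse zero_neq_one)
qed simp

lemma hom_eq_iff [simp]: "h a = h b \<longleftrightarrow> a = b"
  using hom_eq_0_iff[of "a - b"] by (simp del: hom_eq_0_iff)

lemma hom_inverse [simp]: "h (inverse a) = inverse (h a)"
proof (cases "a = 0")
  case False
  then have "h a * h (inverse a) = 1"
    by (simp flip: hom_mult)
  then show ?thesis
    by (simp add: inverse_unique)
qed simp

lemma hom_divide [simp]: "h (a / b) = h a / h b"
  by (simp add: divide_inverse)

lemma hom_power [simp]: "h (a ^ n) = h a ^ n"
  by (induction n) simp_all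

lemma hom_of_nat [simp]: "h (of_nat n) = of_nat n"
  by (induction n) simp_all

lemma hom_numeral [simp]: "h (numeral n) = numeral n"
  using hom_of_nat[of "numeral n"] by (simp del: hom_of_nat)

lemma hom_sum: "h (sum f I) = (\<Sum>i\<in>I. h (f i))"
  by (induction I rule: infinite_finite_induct) simp_all

lemma hom_map_poly_pCons [simp]: "map_poly h (pCons a p) = pCons (h a) (map_poly h p)"
  by (simp add: map_poly_pCons)

lemma hom_map_poly_add [simp]: "map_poly h (p + q) = map_poly h p + map_poly h q"
  by (simp add: poly_eq_iff coeff_map_poly)

lemma hom_map_poly_mult [simp]: "map_poly h (p * q) = map_poly h p * map_poly h q"
  by (simp add: poly_eq_iff coeff_map_poly coeff_mult hom_sum)

lemma hom_map_poly_eq_0_iff [simp]: "map_poly h p = 0 \<longleftrightarrow> p = 0"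
  by (simp add: poly_eq_iff coeff_map_poly)

lemma poly_hom_map_poly: "poly (map_poly h p) (h x) = h (poly p x)"
  by (induction p) simp_all

lemma hom_degree_map_poly [simp]: "degree (map_poly h p) = degree p"
  by (rule degree_map_poly) simp

lemma range_add: "a \<in> range h \<Longrightarrow> b \<in> range h \<Longrightarrow> a + b \<in> range h"
  by (metis (mono_tags, lifting) hom_add image_iff rangeI)

lemma range_mult: "a \<in> range h \<Longrightarrow> b \<in> range h \<Longrightarrow> a * b \<in> range h"
  by (metis (mono_tags, lifting) hom_mult image_iff rangeI)

lemma range_uminus: "a \<in> range h \<Longrightarrow> - a \<in> range h"
  by (metis (mono_tags, lifting) hom_uminus image_iff rangeI)

lemma range_diff: "a \<in> range h \<Longrightarrow> b \<in> range h \<Longrightarrow> a - b \<in> range h"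
  by (metis (mono_tags, lifting) hom_diff image_iff rangeI)

lemma range_divide: "a \<in> range h \<Longrightarrow> b \<in> range h \<Longrightarrow> a / b \<in> range h"
  by (metis (mono_tags, lifting) hom_divide image_iff rangeI)

lemma range_of_nat: "of_nat n \<in> range h"
  by (metis hom_of_nat rangeI)

lemma range_power: "a \<in> range h \<Longrightarrow> a ^ n \<in> range h"
  by (metis (mono_tags, lifting) hom_power image_iff rangeI)

lemma range_sum: "(\<And>i. i \<in> I \<Longrightarrow> f i \<in> range h) \<Longrightarrow> sum f I \<in> range h"
proof (induction I rule: infinite_finite_induct)
  case (insert i I)
  then show ?case by (simp add: range_add)
qed (use hom_zero in \<open>metis rangeI sum.infinite sum.empty\<close>)+

lemma map_poly_preimage:
  assumes "\<And>n. coeff p n \<in> range h"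
  obtains q where "map_poly h q = p"
proof
  show "map_poly h (map_poly (inv_into UNIV h) p) = p"
  proof (rule poly_eqI)
    fix n
    have "inv_into UNIV h 0 = 0"
      by (metis hom_eq_iff inv_f_f injI hom_zero)
    then show "coeff (map_poly h (map_poly (inv_into UNIV h) p)) n = coeff p n"
      by (simp add: coeff_map_poly f_inv_into_f assms)
  qed
qed

end

section \<open>Newton's identities\<close>

text \<open>The shift by one makes this the sum of the series x_i / (1 - x_i X), which is minus the
  logarithmic derivative of the product of the 1 - x_i X.\<close>

definition power_sum_fps :: "'i set \<Rightarrow> ('i \<Rightarrow> 'a::comm_ring_1) \<Rightarrow> 'a fps" where
  "power_sum_fps I x = Abs_fps (\<lambda>m. \<Sum>i\<in>I. x i ^ Suc m)"

text \<open>The product rule for logarithmic derivatives, with the product multiplied out so that it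
  holds over a commutative ring.\<close>

lemma fps_deriv_prod_linear:
  fixes x :: "'i \<Rightarrow> 'a::comm_ring_1"
  assumes "finite I"
  shows "fps_deriv (\<Prod>i\<in>I. 1 - fps_const (x i) * fps_X)
         = - ((\<Prod>i\<in>I. 1 - fps_const (x i) * fps_X) * power_sum_fps I x)"
  using assms
proof (induction I)
  case (insert a I)
  let ?Q = "\<Prod>i\<in>I. 1 - fps_const (x i) * fps_X" and ?u = "1 - fps_const (x a) * fps_X"
  let ?S = "power_sum_fps {a} x"
  have split: "power_sum_fps (insert a I) x = ?S + power_sum_fps I x"
    using insert by (simp add: power_sum_fps_def fps_eq_iff)
  \<comment> \<open>The geometric series.\<close>
  have geo: "?u * ?S = fps_const (x a)"
  proof (rule fps_ext)
    fix n
    show "fps_nth (?u * ?S) n = fps_nth (fps_const (x a)) n"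
      by (cases n) (simp_all add: power_sum_fps_def algebra_simps)
  qed
  have "fps_deriv (?u * ?Q) = - fps_const (x a) * ?Q - ?u * (?Q * power_sum_fps I x)"
    by (simp add: insert.IH fps_deriv_mult)
  also have "\<dots> = - (?u * ?S) * ?Q - ?u * (?Q * power_sum_fps I x)"
    unfolding geo ..
  also have "\<dots> = - (?u * ?Q * (?S + power_sum_fps I x))"
    by (simp add: algebra_simps)
  finally show ?case
    using insert by (simp add: split)
qed (simp add: power_sum_fps_def fps_eq_iff)

text \<open>Coefficient of X^n in the differential equation above. In the reversed polynomial the
  elementary symmetric functions (up to sign) appear in increasing order and vanish beyond
  \<open>card I\<close>, so one formula covers every n.\<close>

lemma newton_identity:
  fixes x :: "'i \<Rightarrow> 'a::comm_ring_1"
  assumes "finite I"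
  shows "of_nat (Suc n) * coeff (\<Prod>i\<in>I. [:1, - x i:]) (Suc n)
         = - (\<Sum>k\<le>n. coeff (\<Prod>i\<in>I. [:1, - x i:]) k * (\<Sum>i\<in>I. x i ^ Suc (n - k)))"
proof -
  let ?p = "\<Prod>i\<in>I. [:1, - x i:]"
  have "fps_of_poly ?p = (\<Prod>i\<in>I. 1 - fps_const (x i) * fps_X)"
    by (simp add: fps_of_poly_prod fps_of_poly_pCons fps_const_neg[symmetric] del: fps_const_neg)
  from fps_deriv_prod_linear[OF assms, of x, folded this]
  have "fps_nth (fps_deriv (fps_of_poly ?p)) n = - fps_nth (fps_of_poly ?p * power_sum_fps I x) n"
    by simp
  then show ?thesis
    by (simp add: fps_mult_nth power_sum_fps_def atMost_atLeast0)
qed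

lemma reflect_poly_prod_linear:
  fixes x :: "'i \<Rightarrow> 'a::idom"
  shows "reflect_poly (\<Prod>i\<in>I. [:- x i, 1:]) = (\<Prod>i\<in>I. [:1, - x i:])"
proof -
  have "reflect_poly [:- x i, 1:] = [:1, - x i:]" for i
    by (cases "x i = 0") (simp_all add: reflect_poly_def)
  then show ?thesis
    by (simp add: reflect_poly_prod)
qed

lemma degree_prod_linear:
  fixes x :: "'i \<Rightarrow> 'a::idom"
  shows "degree (\<Prod>i\<in>I. [:- x i, 1:]) = card I"
  by (subst degree_prod_sum_eq) auto

lemma coeff_prod_linear:
  fixes x :: "'i \<Rightarrow> 'a::idom"
  shows "coeff (\<Prod>i\<in>I. [:1, - x i:]) n =
    (if n > card I then 0 else coeff (\<Prod>i\<in>I. [:- x i, 1:]) (card I - n))"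
  by (simp flip: reflect_poly_prod_linear add: coeff_reflect_poly degree_prod_linear)

context field_embedding
begin

text \<open>Newton's identities, solved for the next coefficient; this requires division by n + 1,
  hence the assumption on the characteristic.\<close>

lemma coeff_in_range_of_power_sums:
  assumes "finite I" and ps: "\<And>n. (\<Sum>i\<in>I. x i ^ n) \<in> range h"
    and char: "\<And>n. (of_nat (Suc n) :: 'k) \<noteq> 0"
  shows "coeff (\<Prod>i\<in>I. [:- x i, 1:]) n \<in> range h"
proof -
  let ?q = "\<Prod>i\<in>I. [:1, - x i:]"
  have q: "coeff ?q n \<in> range h" for n
  proof (induction n rule: less_induct)
    case (less n)
    show ?case
    proof (cases n)
      case 0
      have "coeff ?q 0 = 1"
        by (simp flip: poly_0_coeff_0 add: poly_prod)
      then show ?thesis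
        using 0 hom_one by (metis rangeI)
    next
      case (Suc m)
      have nz: "(of_nat (Suc m) :: 'l) \<noteq> 0"
        using char[of m] hom_eq_0_iff[of "of_nat (Suc m)"] by (metis hom_of_nat)
      have "of_nat (Suc m) * coeff ?q (Suc m) \<in> range h"
        unfolding newton_identity[OF \<open>finite I\<close>]
        by (intro range_uminus range_sum range_mult ps less) (simp add: Suc)
      then have "of_nat (Suc m) * coeff ?q (Suc m) / of_nat (Suc m) \<in> range h"
        by (intro range_divide range_of_nat)
      then show ?thesis
        using nz Suc by simp
    qed
  qed
  show ?thesis
  proof (cases "n \<le> card I")
    case True
    then have "coeff (\<Prod>i\<in>I. [:- x i, 1:]) n = coeff ?q (card I - n)"
      unfolding coeff_prod_linear by simp
    then show ?thesis
      using q by simp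
  next
    case False
    then have "coeff (\<Prod>i\<in>I. [:- x i, 1:]) n = 0"
      by (intro coeff_eq_0) (simp add: degree_prod_linear)
    then show ?thesis
      by (metis hom_zero rangeI)
  qed
qed

text \<open>The same identities, solved for the next power sum, which occurs with coefficient 1 as
  the term k = 0.\<close>

lemma power_sums_in_range_of_coeff:
  assumes "finite I" and co: "\<And>n. coeff (\<Prod>i\<in>I. [:- x i, 1:]) n \<in> range h"
  shows "(\<Sum>i\<in>I. x i ^ n) \<in> range h"
proof (induction n rule: less_induct)
  case (less n)
  let ?q = "\<Prod>i\<in>I. [:1, - x i:]"
  have q: "coeff ?q n \<in> range h" for n
    using co by (auto simp: coeff_prod_linear intro: rev_image_eqI[of 0])
  show ?case
  proof (cases n)
    case 0
    then show ?thesis by (simp add: range_of_nat)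
  next
    case (Suc m)
    have q0: "coeff ?q 0 = 1"
      by (simp flip: poly_0_coeff_0 add: poly_prod)
    have "(\<Sum>k\<le>m. coeff ?q k * (\<Sum>i\<in>I. x i ^ Suc (m - k)))
        = (\<Sum>i\<in>I. x i ^ Suc m) + (\<Sum>k\<in>{..m}-{0}. coeff ?q k * (\<Sum>i\<in>I. x i ^ Suc (m - k)))"
      by (subst sum.remove[of _ 0]) (simp_all add: q0)
    then have "(\<Sum>i\<in>I. x i ^ Suc m) = - (of_nat (Suc m) * coeff ?q (Suc m))
        - (\<Sum>k\<in>{..m}-{0}. coeff ?q k * (\<Sum>i\<in>I. x i ^ Suc (m - k)))"
      unfolding newton_identity[OF \<open>finite I\<close>] by simp
    also have "\<dots> \<in> range h"
      by (intro range_uminus range_diff range_sum range_mult range_of_nat q less) (auto simp: Suc)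
    finally show ?thesis
      using Suc by simp
  qed
qed

end

section \<open>Algebraic closedness of the quadratic extension of a real closed field\<close>

text \<open>Division by a^2 would present -1 as a sum of two squares. Three terms, so that minus a
  sum of two squares can be shown not to be a square.\<close>

lemma formally_real_sum_squares:
  fixes a b c :: "'k::field"
  assumes "formally_real TYPE('k)"
  shows "a\<^sup>2 + b\<^sup>2 + c\<^sup>2 = 0 \<Longrightarrow> a = 0"
proof (rule ccontr)
  assume eq: "a\<^sup>2 + b\<^sup>2 + c\<^sup>2 = 0" and "a \<noteq> 0"
  then have "(b / a)\<^sup>2 + (c / a)\<^sup>2 = - 1"
    by (simp add: power_divide add_divide_distrib[symmetric] divide_eq_eq)
      (metis add.assoc add.commute add_eq_0_iff)
  moreover have "(\<Sum>x\<leftarrow>[b / a, c / a]. x\<^sup>2) \<noteq> - 1"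
    using assms unfolding formally_real_def by blast
  ultimately show False by simp
qed

lemma formally_real_of_nat_neq_0:
  assumes "formally_real TYPE('k::field)"
  shows "(of_nat (Suc n) :: 'k) \<noteq> 0"
proof
  assume "(of_nat (Suc n) :: 'k) = 0"
  then have "(of_nat n :: 'k) = - 1"
    by (simp add: eq_neg_iff_add_eq_0 add.commute)
  moreover have "(\<Sum>x\<leftarrow>replicate n (1::'k). x\<^sup>2) \<noteq> - 1"
    using assms unfolding formally_real_def by blast
  ultimately show False by (simp add: sum_list_replicate)
qed

text \<open>Serves Laplace's argument twice: with constant g it counts unordered pairs, and with
  powers it reduces power sums over unordered pairs to sums over all pairs and over the
  diagonal.\<close>

lemma sum_pairs_less:
  fixes g :: "'i::linorder \<Rightarrow> 'i \<Rightarrow> 'a::comm_semiring_1"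
  assumes "finite I" and "\<And>i j. g i j = g j i"
  shows "(\<Sum>i\<in>I. \<Sum>j\<in>I. g i j) = 2 * (\<Sum>(i,j) | i \<in> I \<and> j \<in> I \<and> i < j. g i j) + (\<Sum>i\<in>I. g i i)"
proof -
  let ?L = "{(i,j). i \<in> I \<and> j \<in> I \<and> i < j}"
  let ?U = "{(i,j). i \<in> I \<and> j \<in> I \<and> j < i}"
  let ?D = "(\<lambda>i. (i,i)) ` I"
  have fin: "finite ?L" "finite ?U"
    by (rule finite_subset[of _ "I \<times> I"]; use assms in auto)+
  have "I \<times> I = ?L \<union> (?U \<union> ?D)" by auto
  then have "(\<Sum>i\<in>I. \<Sum>j\<in>I. g i j) = sum (\<lambda>(i,j). g i j) (?L \<union> (?U \<union> ?D))"
    by (simp add: sum.cartesian_product)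
  also have "\<dots> = sum (\<lambda>(i,j). g i j) ?L + (sum (\<lambda>(i,j). g i j) ?U + sum (\<lambda>(i,j). g i j) ?D)"
    using fin assms(1) by (subst sum.union_disjoint; (subst sum.union_disjoint)?) auto
  also have "sum (\<lambda>(i,j). g i j) ?U = sum (\<lambda>(i,j). g i j) ?L"
    by (rule sum.reindex_bij_witness[of _ prod.swap prod.swap]) (auto simp: assms(2))
  also have "sum (\<lambda>(i,j). g i j) ?D = (\<Sum>i\<in>I. g i i)"
    by (subst sum.reindex) (auto simp: inj_on_def)
  finally show ?thesis
    by (simp add: mult_2 add.assoc)
qed

text \<open>The algebraically closed field is where the roots live; the aim is to find one of them
  in \<open>C\<close>, the copy of K(i) in it.\<close>

locale quadratic_closure = field_embedding h
  for h :: "'k::field \<Rightarrow> 'l::alg_closed_field" +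
  fixes ii :: 'l
  assumes rcf: "real_closed_field TYPE('k)" and i_square: "ii\<^sup>2 = - 1"
begin

definition C :: "'l set" where "C = {h a + ii * h b | a b. True}"

lemma CI: "h a + ii * h b \<in> C"
  by (auto simp: C_def)

lemma CE: assumes "z \<in> C" obtains a b where "z = h a + ii * h b"
  using assms by (auto simp: C_def)

lemma i_mult_i: "ii * ii = - 1"
  using i_square by (simp add: power2_eq_square)

lemma i_mult_i_left: "ii * (ii * x) = - x"
  by (simp add: i_mult_i flip: mult.assoc)

lemma h_in_C: "h a \<in> C"
  using CI[of a 0] by simp

lemma C_add: "z \<in> C \<Longrightarrow> w \<in> C \<Longrightarrow> z + w \<in> C"
  by (elim CE, rule CE[OF CI]) (auto simp: C_def algebra_simps simp flip: hom_add,
      metis hom_add distrib_left add.assoc add.commute)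

lemma C_mult: 
  assumes "z \<in> C" "w \<in> C" shows "z * w \<in> C"
proof -
  from assms obtain a b c d where zw: "z = h a + ii * h b" "w = h c + ii * h d"
    by (auto elim!: CE)
  have "z * w = h a * h c + (ii * ii) * (h b * h d) + ii * (h a * h d + h b * h c)"
    unfolding zw by (simp add: algebra_simps)
  also have "\<dots> = h (a * c - b * d) + ii * h (a * d + b * c)"
    by (simp add: i_mult_i)
  finally show ?thesis by (metis CI)
qed

lemma C_diff: "z \<in> C \<Longrightarrow> w \<in> C \<Longrightarrow> z - w \<in> C"
  using C_add[of z "h (-1) * w"] C_mult[OF h_in_C, of w "- 1"] by simp

lemma C_uminus: "z \<in> C \<Longrightarrow> - z \<in> C"
  using C_mult[OF h_in_C, of z "- 1"] by simp

lemma C_divide: "z \<in> C \<Longrightarrow> z / h a \<in> C"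
  using C_mult[OF h_in_C, of z "inverse a"] by (simp add: field_simps)

lemma real: "formally_real TYPE('k)"
  using rcf by (simp add: real_closed_field_def)

lemma square_or: obtains b :: 'k where "a = b\<^sup>2 \<or> - a = b\<^sup>2"
  using rcf by (auto simp: real_closed_field_def)

lemma odd_root: "odd (degree (p :: 'k poly)) \<Longrightarrow> \<exists>x. poly p x = 0"
  using rcf by (auto simp: real_closed_field_def)

lemma of_nat_eq_0_iff_k: "(of_nat n :: 'k) = 0 \<longleftrightarrow> n = 0"
  using formally_real_of_nat_neq_0[OF real] by (cases n) auto

lemma of_nat_eq_0_iff_l: "(of_nat n :: 'l) = 0 \<longleftrightarrow> n = 0"
  using hom_eq_0_iff[of "of_nat n"] of_nat_eq_0_iff_k by (simp del: hom_eq_0_iff)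

lemma two_neq_0: "(2 :: 'k) \<noteq> 0" "(2 :: 'l) \<noteq> 0"
  using of_nat_eq_0_iff_k[of 2] of_nat_eq_0_iff_l[of 2] by simp_all

text \<open>The half-norm formula: with r^2 = a^2 + b^2, real and imaginary part of the root have
  squares (r + a)/2 and (r - a)/2. Without an order r cannot be chosen positive, so both signs are
  treated.\<close>

lemma C_sqrt:
  assumes "z \<in> C"
  shows "\<exists>w\<in>C. w\<^sup>2 = z"
proof -
  from assms obtain a b where z: "z = h a + ii * h b"
    by (auto elim: CE)
  \<comment> \<open>The imaginary part 2uv of the square must be b, which forces v; only the real
    part is left as a condition.\<close>
  have main: ?thesis if "u \<noteq> 0" and "u\<^sup>2 - (b / (2 * u))\<^sup>2 = a" for u
  proof (rule bexI)
    let ?v = "b / (2 * u)"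
    have "(h u + ii * h v)\<^sup>2 = h (u\<^sup>2 - v\<^sup>2) + ii * h (u * v + u * v)" for v
      by (simp add: power2_eq_square algebra_simps i_mult_i_left)
    moreover have "u * ?v + u * ?v = b"
      using that two_neq_0 by (simp flip: mult_2)
    ultimately show "(h u + ii * h ?v)\<^sup>2 = z"
      using that by (simp only: z)
    show "h u + ii * h ?v \<in> C" by (rule CI)
  qed
  show ?thesis
  proof (cases "b = 0")
    case True
    obtain c where "a = c\<^sup>2 \<or> - a = c\<^sup>2" by (rule square_or)
    then show ?thesis
    proof
      assume "a = c\<^sup>2"
      then show ?thesis using h_in_C[of c] by (intro bexI[of _ "h c"]) (simp_all add: z True)
    next
      assume "- a = c\<^sup>2"
      then have "a = - (c\<^sup>2)" by (metis add.inverse_inverse)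
      then show ?thesis
        using CI[of 0 c] by (intro bexI[of _ "ii * h c"]) (simp_all add: z True power_mult_distrib i_square)
    qed
  next
    case False
    obtain r where r: "a\<^sup>2 + b\<^sup>2 = r\<^sup>2"
    proof -
      obtain r where "a\<^sup>2 + b\<^sup>2 = r\<^sup>2 \<or> - (a\<^sup>2 + b\<^sup>2) = r\<^sup>2" by (rule square_or)
      moreover have "- (a\<^sup>2 + b\<^sup>2) \<noteq> r\<^sup>2"
      proof
        assume "- (a\<^sup>2 + b\<^sup>2) = r\<^sup>2"
        then have "b\<^sup>2 + a\<^sup>2 + r\<^sup>2 = 0"
          by (metis add.commute add.right_inverse)
        with False show False
          using formally_real_sum_squares[OF real] by blast
      qed
      ultimately show ?thesis using that by blast
    qed
    have prod: "((r + a) / 2) * ((r - a) / 2) = (b / 2)\<^sup>2"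
    proof -
      have "(r + a) * (r - a) = b\<^sup>2"
        using r by (simp add: algebra_simps power2_eq_square)
      then show ?thesis by (simp add: power2_eq_square)
    qed
    have diff: "(r + a) / 2 - (r - a) / 2 = a"
    proof -
      have "(r + a) - (r - a) = 2 * a" by simp
      then show ?thesis
        unfolding diff_divide_distrib[symmetric] using two_neq_0 by simp
    qed
    have nz: "(r + a) / 2 \<noteq> 0"
    proof
      assume "(r + a) / 2 = 0"
      then have "(b / 2)\<^sup>2 = 0"
        using prod by (metis mult_zero_left)
      with False two_neq_0 show False by simp
    qed
    obtain u where "(r + a) / 2 = u\<^sup>2 \<or> - ((r + a) / 2) = u\<^sup>2" by (rule square_or)
    then show ?thesis
    proof
      assume u: "(r + a) / 2 = u\<^sup>2"
      then have "u \<noteq> 0"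
        using nz by (metis neg_equal_0_iff_equal zero_power2)
      moreover have "(b / (2 * u))\<^sup>2 = (r - a) / 2"
      proof -
        have "(b / (2 * u))\<^sup>2 = (b / 2)\<^sup>2 / u\<^sup>2"
          by (simp add: power_divide power_mult_distrib)
        also have "\<dots> = (r - a) / 2"
          unfolding prod[symmetric] u using \<open>u \<noteq> 0\<close> by simp
        finally show ?thesis .
      qed
      ultimately show ?thesis
        using main[of u] diff u by metis
    next
      \<comment> \<open>Here r is the negative modulus, and u becomes the imaginary part instead of
        the real part.\<close>
      assume u: "- ((r + a) / 2) = u\<^sup>2"
      then have "u \<noteq> 0"
        using nz by (metis neg_equal_0_iff_equal zero_power2)
      define v where "v = b / (2 * u)"
      have v: "v \<noteq> 0" "b / (2 * v) = u"
        using False \<open>u \<noteq> 0\<close> two_neq_0 by (simp_all add: v_def)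
      have ru: "(r + a) / 2 = - (u\<^sup>2)"
        using u by (metis add.inverse_inverse)
      have "v\<^sup>2 = (b / 2)\<^sup>2 / u\<^sup>2"
        by (simp add: v_def power_divide power_mult_distrib)
      also have "\<dots> = - ((r - a) / 2)"
        unfolding prod[symmetric] ru using \<open>u \<noteq> 0\<close> by simp
      finally have v2: "v\<^sup>2 = - ((r - a) / 2)" .
      have "v\<^sup>2 - u\<^sup>2 = a"
        unfolding v2 u[symmetric] using diff by (metis minus_diff_minus minus_diff_eq)
      then show ?thesis
        using main[of v] v by simp
    qed
  qed
qed

text \<open>The discriminant of the quadratic with roots x and y is (x - y)^2, and it has a square
  root in \<open>C\<close>.\<close>

lemma C_quadratic:
  assumes "x + y \<in> C" "x * y \<in> C"
  shows "x \<in> C"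
proof -
  have "(x + y) * (x + y) - h 4 * (x * y) \<in> C"
    by (intro C_diff C_mult assms h_in_C)
  then obtain w where w: "w \<in> C" "w\<^sup>2 = (x + y) * (x + y) - h 4 * (x * y)"
    using C_sqrt by blast
  have h24: "h 4 = 4" "h 2 = 2"
    using hom_of_nat[of 4] hom_of_nat[of 2] by (simp_all del: hom_of_nat)
  have "w\<^sup>2 = (x - y)\<^sup>2"
    unfolding w(2) h24 by (simp add: power2_eq_square algebra_simps)
  then have "w = x - y \<or> - w = x - y"
    by (metis power2_eq_iff add.inverse_inverse)
  moreover have "- w \<in> C"
    using w(1) by (rule C_uminus)
  ultimately have "x - y \<in> C"
    using w(1) by metis
  then have "((x - y) + (x + y)) / h 2 \<in> C"
    by (intro C_divide C_add assms)
  moreover have "(x - y) + (x + y) = 2 * x" by simp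
  ultimately show ?thesis
    using two_neq_0 by (simp add: h24)
qed

text \<open>Laplace's argument: passing from the roots \<open>x i\<close> to \<open>x i + x j + t * (x i * x j)\<close>
  for \<open>i < j\<close> lowers the \<open>2\<close>-adic valuation of the number of roots. That the elements are the
  roots of a polynomial over the base field is expressed by their power sums.\<close>

lemma laplace:
  assumes "finite (I :: nat set)" and "card I = 2 ^ k * m" and "odd m"
    and "\<And>n. (\<Sum>i\<in>I. x i ^ n) \<in> range h"
  shows "\<exists>i\<in>I. x i \<in> C"
  using assms
proof (induction k arbitrary: I m x)
  case 0
  have "\<And>n. coeff (\<Prod>i\<in>I. [:- x i, 1:]) n \<in> range h"
    by (rule coeff_in_range_of_power_sums)
      (use 0 formally_real_of_nat_neq_0[OF real] in auto)
  then obtain q where q: "map_poly h q = (\<Prod>i\<in>I. [:- x i, 1:])"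
    by (rule map_poly_preimage)
  have "degree q = card I"
    using hom_degree_map_poly[of q] by (simp only: q degree_prod_linear)
  then obtain r where "poly q r = 0"
    using odd_root 0 by auto
  then have "poly (\<Prod>i\<in>I. [:- x i, 1:]) (h r) = 0"
    by (simp flip: q add: poly_hom_map_poly)
  then obtain i where "i \<in> I" "x i = h r"
    using \<open>finite I\<close> by (auto simp: poly_prod)
  then show ?case using h_in_C by metis
next
  case (Suc k)
  define J where "J = {(i,j). i \<in> I \<and> j \<in> I \<and> i < j}"
  have finJ: "finite J"
    by (rule finite_subset[of _ "I \<times> I"]) (use Suc in \<open>auto simp: J_def\<close>)
  define f where "f t i j = x i + x j + of_nat t * (x i * x j)" for t :: nat and i j
  have "\<exists>p\<in>J. f t (fst p) (snd p) \<in> C" for t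
  proof -
    define N where "N = 2 ^ Suc k * m"
    \<comment> \<open>The number of pairs is N(N - 1)/2 with N even, so it loses exactly one factor
      2.\<close>
    have N: "N > 0" "card I = N"
      using Suc.prems by (auto simp: N_def intro: odd_pos)
    have "card I * card I = 2 * card J + card I"
      using sum_pairs_less[OF \<open>finite I\<close>, of "\<lambda>_ _. 1::nat"] by (simp add: J_def case_prod_unfold)
    then have "2 * card J = N * (N - 1)"
      using N by (simp add: diff_mult_distrib2)
    then have "card J = 2 ^ k * (m * (N - 1))"
      by (simp add: N_def)
    moreover have "odd (m * (N - 1))"
      using N \<open>odd m\<close> by (simp add: N_def)
    \<comment> \<open>The induction runs over index sets of naturals; pairs are therefore encoded as
      numbers.\<close>
    moreover have inj: "inj_on prod_encode J"
      by (rule inj_prod_encode)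
    moreover have "(\<Sum>k\<in>prod_encode ` J. case_prod (f t) (prod_decode k) ^ n) \<in> range h" for n
    proof -
      have half: "(\<Sum>(i,j)\<in>J. f t i j ^ n) =
          ((\<Sum>i\<in>I. \<Sum>j\<in>I. f t i j ^ n) - (\<Sum>i\<in>I. f t i i ^ n)) / of_nat 2"
        using sum_pairs_less[OF \<open>finite I\<close>, of "\<lambda>i j. f t i j ^ n"] two_neq_0
        by (simp add: J_def f_def add.commute mult.commute)
      \<comment> \<open>Two binomial expansions turn the power into monomials in x i and x j; summed
        over all i and j, each monomial splits into a product of two power sums.\<close>
      have expand: "f t i j ^ n = (\<Sum>a\<le>n. \<Sum>b\<le>a. of_nat (n choose a) * of_nat (a choose b) *
          of_nat t ^ (n - a) * (x i ^ (b + (n - a)) * x j ^ (a - b + (n - a))))" for i j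
        unfolding f_def binomial_ring[of "x i + x j"] binomial_ring[of "x i" "x j"]
          sum_distrib_left sum_distrib_right power_mult_distrib power_add
        by (intro sum.cong refl) (simp only: mult_ac)
      have swap: "(\<Sum>i\<in>I. \<Sum>a\<le>n. \<Sum>b\<le>a. G a b i) = (\<Sum>a\<le>n. \<Sum>b\<le>a. \<Sum>i\<in>I. G a b i)"
        for G :: "nat \<Rightarrow> nat \<Rightarrow> nat \<Rightarrow> 'l"
        by (subst sum.swap) (intro sum.cong refl sum.swap)
      have "(\<Sum>i\<in>I. \<Sum>j\<in>I. f t i j ^ n) = (\<Sum>a\<le>n. \<Sum>b\<le>a. of_nat (n choose a) * of_nat (a choose b) *
          of_nat t ^ (n - a) * ((\<Sum>i\<in>I. x i ^ (b + (n - a))) * (\<Sum>j\<in>I. x j ^ (a - b + (n - a)))))"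
        unfolding sum_product unfolding expand sum_distrib_left swap ..
      also have "\<dots> \<in> range h"
        by (intro range_sum range_mult range_of_nat range_power Suc.prems)
      finally have all: "(\<Sum>i\<in>I. \<Sum>j\<in>I. f t i j ^ n) \<in> range h" .
      have "(\<Sum>i\<in>I. f t i i ^ n) = (\<Sum>a\<le>n. \<Sum>b\<le>a. of_nat (n choose a) * of_nat (a choose b) *
          of_nat t ^ (n - a) * (\<Sum>i\<in>I. x i ^ (b + (n - a) + (a - b + (n - a)))))"
        unfolding expand sum_distrib_left power_add[symmetric] swap ..
      also have "\<dots> \<in> range h"
        by (intro range_sum range_mult range_of_nat range_power Suc.prems)
      finally have "(\<Sum>i\<in>I. f t i i ^ n) \<in> range h" .
      with all have "(\<Sum>(i,j)\<in>J. f t i j ^ n) \<in> range h"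
        unfolding half by (intro range_divide range_diff range_of_nat)
      then show ?thesis
        by (simp add: sum.reindex[OF inj] case_prod_unfold)
    qed
    ultimately have "\<exists>k\<in>prod_encode ` J. case_prod (f t) (prod_decode k) \<in> C"
      using finJ by (intro Suc.IH[where m = "m * (N - 1)"]) (auto simp: card_image)
    then show ?thesis
      by (auto simp: case_prod_unfold)
  qed
  then obtain p where p: "\<And>t. p t \<in> J" "\<And>t. f t (fst (p t)) (snd (p t)) \<in> C"
    by metis
  \<comment> \<open>There are finitely many pairs but infinitely many t, so one pair works for two
    values of t. Subtracting the two elements isolates the product of the roots, and then their
    sum.\<close>
  have "finite (range p)"
    using finJ p(1) by (meson finite_subset image_subsetI)
  then obtain t0 where "infinite {t. p t = p t0}"
    using pigeonhole_infinite[of UNIV p] by auto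
  then obtain t where t: "t > t0" "p t = p t0"
    by (auto simp: infinite_nat_iff_unbounded)
  obtain i j where ij: "p t0 = (i,j)" by fastforce
  have iI: "i \<in> I"
    using p(1)[of t0] ij by (simp add: J_def)
  have in_C: "f t i j \<in> C" "f t0 i j \<in> C"
    using p(2)[of t] p(2)[of t0] t(2) ij by simp_all
  have t_eq: "(of_nat t :: 'l) = of_nat (t - t0) + of_nat t0"
    using t(1) by (simp flip: of_nat_add)
  have "(f t i j - f t0 i j) / h (of_nat (t - t0)) \<in> C"
    by (intro C_divide C_diff in_C)
  moreover have "f t i j - f t0 i j = of_nat (t - t0) * (x i * x j)"
    unfolding f_def t_eq by (simp add: algebra_simps)
  ultimately have prod_C: "x i * x j \<in> C"
    using t(1) of_nat_eq_0_iff_l[of "t - t0"] by simp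
  then have "f t0 i j - h (of_nat t0) * (x i * x j) \<in> C"
    by (rule C_diff[OF in_C(2) C_mult[OF h_in_C]])
  then have "x i + x j \<in> C"
    by (simp add: f_def)
  then show ?case
    using C_quadratic prod_C iI by blast
qed

end

context quadratic_closure
begin


text \<open>The roots in the algebraically closed field are indexed by list positions, which keeps
  multiplicities; their power sums lie in the base field, so Laplace's argument applies.\<close>

lemma poly_root_in_C:
  fixes p :: "'k poly"
  assumes "degree p > 0"
  shows "\<exists>z\<in>C. poly (map_poly h p) z = 0"
proof -
  let ?p = "map_poly h p"
  obtain A where A: "?p = smult (lead_coeff ?p) (\<Prod>x\<in>#A. [:- x, 1:])"
    using alg_closed_imp_factorization[of ?p] assms by fastforce
  obtain xs where xs: "A = mset xs"
    using ex_mset by metis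
  define I where "I = {..<length xs}"
  let ?q = "\<Prod>i\<in>I. [:- (xs ! i), 1:]"
  have "(\<Prod>x\<in>#A. [:- x, 1:]) = (\<Prod>x\<leftarrow>xs. [:- x, 1:])"
    unfolding xs prod_mset_prod_list[symmetric] by simp
  also have "\<dots> = ?q"
    unfolding I_def by (simp add: prod.list_conv_set_nth lessThan_atLeast0)
  finally have p: "?p = smult (h (lead_coeff p)) ?q"
    using A by (simp add: coeff_map_poly)
  have lc: "lead_coeff p \<noteq> 0"
    using assms by auto
  have "coeff ?q n = h (coeff p n) / h (lead_coeff p)" for n
    using arg_cong[OF p, of "\<lambda>p. coeff p n"] lc by (simp add: coeff_map_poly)
  then have "coeff ?q n \<in> range h" for n
    by (metis hom_divide rangeI)
  then have ps: "(\<Sum>i\<in>I. (xs ! i) ^ n) \<in> range h" for n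
    by (intro power_sums_in_range_of_coeff) (simp_all add: I_def)
  have "card I = degree p"
    using arg_cong[OF p, of degree] lc assms by (auto simp: degree_prod_linear)
  then have "card I \<noteq> 0"
    using assms by simp
  then obtain m where m: "card I = 2 ^ multiplicity 2 (card I) * m" "odd m"
    using multiplicity_decompose'[of "card I" 2] by auto
  obtain i where "i \<in> I" "xs ! i \<in> C"
    using laplace[OF _ m ps] by (auto simp: I_def)
  then show ?thesis
    by (intro bexI[of _ "xs ! i"]) (auto simp: p poly_prod I_def)
qed

text \<open>A root a + ib with b nonzero has minimal polynomial (X - a)^2 + b^2. It is kept as a sum
  of squares because this displays its sign.\<close>

lemma poly_has_linear_or_quadratic_factor:
  fixes p :: "'k poly"
  assumes "degree p > 0"
  shows "\<exists>a. [:- a, 1:] dvd p \<or> (\<exists>b. b \<noteq> 0 \<and> [:- a, 1:]\<^sup>2 + [:b:]\<^sup>2 dvd p)"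
proof -
  obtain z where "z \<in> C" and root: "poly (map_poly h p) z = 0"
    using poly_root_in_C[OF assms] by blast
  then obtain a b where z: "z = h a + ii * h b"
    by (auto elim: CE)
  show ?thesis
  proof (cases "b = 0")
    case True
    then have "poly p a = 0"
      using root z by (simp add: poly_hom_map_poly)
    then show ?thesis
      by (auto simp: poly_eq_0_iff_dvd)
  next
    case False
    let ?d = "[:- a, 1:]\<^sup>2 + [:b:]\<^sup>2"
    have d: "?d = [:a\<^sup>2 + b\<^sup>2, - 2 * a, 1:]"
      by (simp add: power2_eq_square)
    have "degree (p mod ?d) < 2"
      using degree_mod_less[of ?d p] by (auto simp: d)
    then obtain c e where r: "p mod ?d = [:e, c:]"
      by (cases "p mod ?d" rule: pCons_cases, rename_tac e q, case_tac q rule: pCons_cases)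
        (auto split: if_splits)
    have "poly (map_poly h ?d) z = 0"
      unfolding d z by (simp add: power2_eq_square algebra_simps i_mult_i i_mult_i_left)
    moreover have "map_poly h p = map_poly h (p div ?d) * map_poly h ?d + map_poly h (p mod ?d)"
      by (metis div_mult_mod_eq hom_map_poly_add hom_map_poly_mult)
    ultimately have "poly (map_poly h (p mod ?d)) z = 0"
      using root by simp
    then have eq: "h e + h a * h c + ii * (h b * h c) = 0"
      unfolding r z by (simp add: algebra_simps)
    \<comment> \<open>The remainder has degree at most 1 and vanishes at z. A nonzero slope would
      put \<open>ii\<close> into the base field, making -1 a square there.\<close>
    have "c = 0"
    proof (rule ccontr)
      assume "c \<noteq> 0"
      with eq False have "ii = h (- (e + a * c) / (b * c))"
        by (simp add: field_simps eq_neg_iff_add_eq_0)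
      then obtain s where "ii = h s" by blast
      then have "h (s\<^sup>2 + 1) = 0"
        using i_square by simp
      then have "s\<^sup>2 + 1 = 0"
        by (simp only: hom_eq_0_iff)
      then show False
        using formally_real_sum_squares[OF real, of 1 s 0] by (simp add: add.commute)
    qed
    with eq have "e = 0" by simp
    with \<open>c = 0\<close> r have "?d dvd p"
      by (simp add: dvd_eq_mod_eq_0)
    with False show ?thesis by blast
  qed
qed

end

text \<open>Hides the algebraic closure from the sign argument: a property has to be checked only
  for the irreducible factors and for products.\<close>

lemma real_closed_field_poly_induct [consumes 2, case_names const linear quadratic mult]:
  fixes p :: "'k::field poly"
  assumes rcf: "real_closed_field TYPE('k)" and "p \<noteq> 0"
    and const: "\<And>c. c \<noteq> 0 \<Longrightarrow> P [:c:]"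
    and linear: "\<And>a. P [:- a, 1:]"
    and quadratic: "\<And>a b. b \<noteq> 0 \<Longrightarrow> P ([:- a, 1:]\<^sup>2 + [:b:]\<^sup>2)"
    and mult: "\<And>p q. p \<noteq> 0 \<Longrightarrow> q \<noteq> 0 \<Longrightarrow> P p \<Longrightarrow> P q \<Longrightarrow> P (p * q)"
  shows "P p"
proof -
  obtain ii :: "'k alg_closure" where "ii ^ 2 = - 1"
    using nth_root_exists[of 2 "- 1 :: 'k alg_closure"] by auto
  then interpret quadratic_closure "to_ac :: 'k \<Rightarrow> _" ii
    using rcf by unfold_locales (auto simp: field_hom_def)
  show ?thesis
    using \<open>p \<noteq> 0\<close>
  proof (induction "degree p" arbitrary: p rule: less_induct)
    case less
    show ?case
    proof (cases "degree p = 0")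
      case True
      then show ?thesis
        using const less.prems by (metis degree_eq_zeroE pCons_0_0)
    next
      case False
      then obtain d where d: "d dvd p" "P d" "degree d > 0"
      proof -
        obtain a where "[:- a, 1:] dvd p \<or> (\<exists>b. b \<noteq> 0 \<and> [:- a, 1:]\<^sup>2 + [:b:]\<^sup>2 dvd p)"
          using poly_has_linear_or_quadratic_factor[of p] False by auto
        then show thesis
        proof (elim disjE exE conjE)
          assume "[:- a, 1:] dvd p"
          then show thesis by (rule that) (use linear in auto)
        next
          fix b assume "b \<noteq> 0" "[:- a, 1:]\<^sup>2 + [:b:]\<^sup>2 dvd p"
          moreover have "degree ([:- a, 1:]\<^sup>2 + [:b:]\<^sup>2) > 0"
            by (simp add: power2_eq_square)
          ultimately show thesis
            using that quadratic by blast
        qed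
      qed
      then obtain q where q: "p = d * q" by blast
      with less.prems have "d \<noteq> 0" "q \<noteq> 0" by auto
      moreover have "degree q < degree p"
        using d(3) \<open>d \<noteq> 0\<close> \<open>q \<noteq> 0\<close> by (simp add: q degree_mult_eq)
      ultimately show ?thesis
        unfolding q by (intro mult d(2) less.hyps) (simp_all add: q)
    qed
  qed
qed

section \<open>Real places\<close>

locale real_place_on =
  fixes \<zeta> :: "'k::field \<Rightarrow> real option"
  assumes real_place: "real_place \<zeta>"
begin

lemma place_one [simp]: "\<zeta> 1 = Some 1"
  using real_place by (simp add: real_place_def)

lemma place_add: "\<zeta> a = Some r \<Longrightarrow> \<zeta> b = Some s \<Longrightarrow> \<zeta> (a + b) = Some (r + s)"
  and place_mult: "\<zeta> a = Some r \<Longrightarrow> \<zeta> b = Some s \<Longrightarrow> \<zeta> (a * b) = Some (r * s)"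
  using real_place by (simp_all add: real_place_def)

lemma place_None_iff: "a \<noteq> 0 \<Longrightarrow> \<zeta> a = None \<longleftrightarrow> \<zeta> (inverse a) = Some 0"
  using real_place by (simp add: real_place_def)

lemma place_minus_one: "\<zeta> (- 1) = Some (- 1)" and place_zero [simp]: "\<zeta> 0 = Some 0"
proof -
  \<comment> \<open>-1 is its own inverse, so an infinite value would also be the value 0.\<close>
  obtain r where r: "\<zeta> (- 1) = Some r"
    using place_None_iff[of "- 1"] by (cases "\<zeta> (- 1)") auto
  from place_add[OF place_one this] have "\<zeta> 0 = Some (1 + r)" by simp
  moreover from place_add[OF this place_one] have "1 + r = 0" by simp
  ultimately show "\<zeta> (- 1) = Some (- 1)" "\<zeta> 0 = Some 0"
    using r by auto
qed

lemma place_uminus: "\<zeta> a = Some r \<Longrightarrow> \<zeta> (- a) = Some (- r)"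
  using place_mult[OF place_minus_one] by fastforce

lemma place_diff: "\<zeta> a = Some r \<Longrightarrow> \<zeta> b = Some s \<Longrightarrow> \<zeta> (a - b) = Some (r - s)"
  using place_add[OF _ place_uminus] by fastforce

lemma place_power: "\<zeta> a = Some r \<Longrightarrow> \<zeta> (a ^ n) = Some (r ^ n)"
  by (induction n) (simp_all add: place_mult)

lemma place_of_nat [simp]: "\<zeta> (of_nat n) = Some (of_nat n)"
  by (induction n) (simp_all add: place_add)

lemma place_of_int [simp]: "\<zeta> (of_int n) = Some (of_int n)"
  by (cases n rule: int_cases2) (simp_all add: place_uminus)

lemma place_inverse: "\<zeta> a = Some r \<Longrightarrow> r \<noteq> 0 \<Longrightarrow> \<zeta> (inverse a) = Some (inverse r)"
proof -
  assume a: "\<zeta> a = Some r" and "r \<noteq> 0"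
  then have "a \<noteq> 0" by auto
  then obtain s where s: "\<zeta> (inverse a) = Some s"
    using a \<open>r \<noteq> 0\<close> place_None_iff[of "inverse a"] by (cases "\<zeta> (inverse a)") auto
  from place_mult[OF a this] \<open>a \<noteq> 0\<close> have "r * s = 1" by simp
  with s show ?thesis by (simp add: inverse_unique)
qed

lemma place_divide: "\<zeta> a = Some r \<Longrightarrow> \<zeta> b = Some s \<Longrightarrow> s \<noteq> 0 \<Longrightarrow> \<zeta> (a / b) = Some (r / s)"
  unfolding divide_inverse by (intro place_mult place_inverse)

lemma place_inverse_of_None: "\<zeta> a = None \<Longrightarrow> \<zeta> (inverse a) = Some 0"
  by (cases "a = 0") (simp_all flip: place_None_iff)

lemma place_inverse_of_zero: "\<zeta> a = Some 0 \<Longrightarrow> a \<noteq> 0 \<Longrightarrow> \<zeta> (inverse a) = None"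
  using place_None_iff[of "inverse a"] by simp

lemma place_mult_unit:
  assumes "\<zeta> u = Some s" "s \<noteq> 0" shows "\<zeta> (a * u) = map_option (\<lambda>r. r * s) (\<zeta> a)"
proof (cases "\<zeta> a")
  case None
  have "u \<noteq> 0" using assms by auto
  then have eq: "a * u * inverse u = a" by simp
  then have "\<zeta> (a * u) = None"
    using place_mult[OF _ place_inverse[OF assms], of "a * u"] None
    unfolding eq by (cases "\<zeta> (a * u)") auto
  with None show ?thesis by simp
qed (simp add: place_mult[OF _ assms(1)])

lemma place_square_None: "\<zeta> a = None \<Longrightarrow> \<zeta> (a\<^sup>2) = None"
proof -
  assume a: "\<zeta> a = None"
  then have "\<zeta> (inverse (a\<^sup>2)) = Some 0"
    using place_power[OF place_inverse_of_None, of a 2] by (simp add: power_inverse)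
  moreover have "a\<^sup>2 \<noteq> 0" using a by auto
  ultimately show ?thesis by (simp add: place_None_iff)
qed

lemma place_square_nonneg: "\<zeta> (a\<^sup>2) = Some r \<Longrightarrow> r \<ge> 0"
  using place_square_None[of a] place_power[of a _ 2] by (cases "\<zeta> a") auto

lemma place_ratio: "(\<exists>r. \<zeta> (a / b) = Some r) \<or> \<zeta> (b / a) = Some 0"
  using place_inverse_of_None[of "a / b"] by (cases "\<zeta> (a / b)") auto

end

lemma places_iff: "\<zeta> \<in> places \<longleftrightarrow> real_place_on \<zeta>"
  by (simp add: places_def real_place_on_def)

lemma (in field_embedding) real_place_comp:
  "real_place \<zeta> \<Longrightarrow> real_place (\<zeta> \<circ> h)"
  by (auto simp: real_place_def)

lemma (in field_embedding) restrict_place_in_places: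
  "\<zeta> \<in> places \<Longrightarrow> restrict_place h \<zeta> \<in> places"
  by (simp add: places_def restrict_place_def real_place_comp)

text \<open>As P decides every element, nonnegativity on P implies that elements of positive value
  lie in P. So P sees the value of a through its comparison with rationals.\<close>

lemma place_eq_ordering_place:
  assumes P: "field_ordering P" and "real_place \<zeta>"
    and nonneg: "\<And>a r. a \<in> P \<Longrightarrow> \<zeta> a = Some r \<Longrightarrow> r \<ge> 0"
  shows "\<zeta> = ordering_place P"
proof
  fix a
  interpret real_place_on \<zeta> by unfold_locales fact
  have neg: "a \<in> P" if "\<zeta> a = Some r" "r > 0" for a r
  proof (rule ccontr)
    assume "a \<notin> P"
    then have "- a \<in> P"
      using P unfolding field_ordering_def by blast
    from nonneg[OF this place_uminus[OF that(1)]] that(2) show False by simp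
  qed
  have mult: "b * c \<in> P" if "b \<in> P" "c \<in> P" for b c
    using P that unfolding field_ordering_def by blast
  have square: "b * b \<in> P" for b
  proof -
    have "b \<in> P \<or> - b \<in> P"
      using P unfolding field_ordering_def by blast
    then show ?thesis
      using mult[of b b] mult[of "- b" "- b"] by auto
  qed
  show "\<zeta> a = ordering_place P a"
  proof (cases "\<zeta> a")
    case None
    have "\<not> (of_nat n - a \<in> P \<and> of_nat n + a \<in> P)" for n :: nat
    proof
      assume "of_nat n - a \<in> P \<and> of_nat n + a \<in> P"
      \<comment> \<open>If a were bounded by n, then (n^2 - a^2) / a^2 would lie in P; its value at
        an infinite a is -1.\<close>
      then have "(of_nat n - a) * (of_nat n + a) * (inverse a * inverse a) \<in> P"
        by (intro mult square) simp_all
      moreover have "a \<noteq> 0" using None by auto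
      then have "(of_nat n - a) * inverse a = of_nat n * inverse a - 1"
        "(of_nat n + a) * inverse a = of_nat n * inverse a + 1"
        by (simp_all add: left_diff_distrib distrib_right)
      then have "(of_nat n - a) * (of_nat n + a) * (inverse a * inverse a)
        = (of_nat n * inverse a - 1) * (of_nat n * inverse a + 1)"
        by (metis mult.assoc mult.left_commute)
      ultimately have "(of_nat n * inverse a - 1) * (of_nat n * inverse a + 1) \<in> P"
        by (simp only:)
      moreover have "\<zeta> ((of_nat n * inverse a - 1) * (of_nat n * inverse a + 1)) = Some ((of_nat n * 0 - 1) * (of_nat n * 0 + 1))"
        by (intro place_mult place_diff place_add place_of_nat place_one place_inverse_of_None None)
      ultimately show False
        using nonneg by (metis add.left_neutral diff_0 mult_zero_right mult_1_right not_one_le_zero neg_0_le_iff_le)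
    qed
    then have nex: "\<not> (\<exists>n::nat. of_nat n - a \<in> P \<and> of_nat n + a \<in> P)" by blast
    show ?thesis
      unfolding ordering_place_def if_not_P[OF nex] None ..
  next
    case (Some r)
    obtain n :: nat where n: "\<bar>r\<bar> < n" using reals_Archimedean2 by blast
    have "of_nat n - a \<in> P"
      by (rule neg[OF place_diff[OF place_of_nat Some]]) (use n in simp)
    moreover have "of_nat n + a \<in> P"
      by (rule neg[OF place_add[OF place_of_nat Some]]) (use n in simp)
    ultimately have ex: "\<exists>n::nat. of_nat n - a \<in> P \<and> of_nat n + a \<in> P" by blast
    \<comment> \<open>The set consists of the rationals that P puts below a. None exceeds r, and
      every rational smaller than r is among them.\<close>
    have "Sup {real_of_int m / real n | m n. n > 0 \<and> of_nat n * a - of_int m \<in> P} = r" (is "Sup ?S = r")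
    proof (rule cSup_eq)
      fix x assume "x \<in> ?S"
      then obtain m n where x: "x = real_of_int m / real n" "n > 0" "of_nat n * a - of_int m \<in> P"
        by auto
      then have "of_nat n * r - of_int m \<ge> 0"
        by (intro nonneg[of "of_nat n * a - of_int m"] place_diff place_mult) (simp_all add: Some)
      with x(2) show "x \<le> r" unfolding x(1) by (simp add: pos_divide_le_eq mult.commute)
    next
      fix y assume y: "\<And>x. x \<in> ?S \<Longrightarrow> x \<le> y"
      show "r \<le> y"
      proof (rule ccontr)
        assume "\<not> r \<le> y"
        then have "y < r" by simp
        then obtain q where q: "q \<in> \<rat>" "y < q" "q < r"
          using Rats_dense_in_real[of y r] by blast
        then obtain m :: int and n :: int where mn: "n > 0" "q = of_int m / of_int n"
          by (auto elim: Rats_cases')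
        have "real_of_int m < real_of_int n * r"
          using q mn by (simp add: field_simps)
        then have "of_nat (nat n) * a - of_int m \<in> P"
          using mn by (intro neg[of _ "of_nat (nat n) * r - of_int m"] place_diff place_mult)
            (simp_all add: Some)
        moreover have "q = real_of_int m / real (nat n)" "nat n > 0"
          using mn by simp_all
        ultimately have "q \<le> y"
          by (intro y) blast
        with q show False by simp
      qed
    qed
    then show ?thesis
      unfolding ordering_place_def if_P[OF ex] Some by (rule arg_cong[OF sym])
  qed
qed

section \<open>Preorderings\<close>

text \<open>Partial orderings of this kind suffice because each application asks for the signs of
  finitely many elements.\<close>

definition preordering :: "'k::field set \<Rightarrow> bool" where
  "preordering T \<longleftrightarrow> (\<forall>a\<in>T. \<forall>b\<in>T. a + b \<in> T \<and> a * b \<in> T) \<and> (\<forall>a. a\<^sup>2 \<in> T) \<and> - 1 \<notin> T"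

lemma preordering_add: "preordering T \<Longrightarrow> a \<in> T \<Longrightarrow> b \<in> T \<Longrightarrow> a + b \<in> T"
  and preordering_mult: "preordering T \<Longrightarrow> a \<in> T \<Longrightarrow> b \<in> T \<Longrightarrow> a * b \<in> T"
  and preordering_square: "preordering T \<Longrightarrow> a\<^sup>2 \<in> T"
  and preordering_minus_one: "preordering T \<Longrightarrow> - 1 \<notin> T"
  by (auto simp: preordering_def)

lemma preordering_antisym:
  assumes T: "preordering T" and "a \<in> T" "- a \<in> T"
  shows "a = 0"
proof (rule ccontr)
  assume "a \<noteq> 0"
  then have "- 1 = a * (- a) * (inverse a)\<^sup>2"
    by (simp add: field_simps power2_eq_square)
  also have "\<dots> \<in> T"
    using assms by (intro preordering_mult preordering_square)
  finally show False using preordering_minus_one[OF T] by simp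
qed

text \<open>Adjoining x gives T + Tx. If -1 = s + tx, then -x = (1 + s) t / t^2 already lies in
  T.\<close>

lemma preordering_extend:
  assumes T: "preordering T"
  shows "\<exists>T'. preordering T' \<and> T \<subseteq> T' \<and> (x \<in> T' \<or> - x \<in> T')"
proof (cases "- x \<in> T")
  case False
  define T' where "T' = {s + t * x | s t. s \<in> T \<and> t \<in> T}"
  have T'I: "s + t * x \<in> T'" if "s \<in> T" "t \<in> T" for s t
    using that by (auto simp: T'_def)
  have zero: "0 \<in> T" and one: "1 \<in> T"
    using preordering_square[OF T, of 0] preordering_square[OF T, of 1] by simp_all
  have sub: "T \<subseteq> T'"
  proof
    fix s assume "s \<in> T"
    from T'I[OF this zero] show "s \<in> T'" by simp
  qed
  have "a + b \<in> T' \<and> a * b \<in> T'" if ab: "a \<in> T'" "b \<in> T'" for a b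
  proof -
    obtain s t u v where *: "a = s + t * x" "b = u + v * x" "s \<in> T" "t \<in> T" "u \<in> T" "v \<in> T"
      using ab by (auto simp: T'_def)
    have "a + b = (s + u) + (t + v) * x" "a * b = (s * u + t * v * x\<^sup>2) + (s * v + t * u) * x"
      by (simp_all add: * algebra_simps power2_eq_square)
    then show ?thesis
      using * T by (metis T'I preordering_add preordering_mult preordering_square)
  qed
  moreover have "- 1 \<notin> T'"
  proof
    assume "- 1 \<in> T'"
    then obtain s t where st: "- 1 = s + t * x" "s \<in> T" "t \<in> T" by (auto simp: T'_def)
    have "t \<noteq> 0" using st preordering_minus_one[OF T] by auto
    have "t * (- x) = 1 + s"
      using arg_cong[OF st(1), of "\<lambda>z. s - z"] by (simp add: add.commute)
    with \<open>t \<noteq> 0\<close> have "- x = (1 + s) * t * (inverse t)\<^sup>2"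
      by (simp add: power2_eq_square field_simps flip: minus_mult_right)
    also have "\<dots> \<in> T"
      using T st one by (intro preordering_mult preordering_add preordering_square)
    finally show False using False by simp
  qed
  moreover have "x \<in> T'" using T'I[OF zero one] by simp
  ultimately show ?thesis
    using sub T by (intro exI[of _ T']) (auto simp: preordering_def)
qed (use T in blast)

lemma preordering_extend_finite:
  assumes "preordering T" "finite S"
  shows "\<exists>T'. preordering T' \<and> T \<subseteq> T' \<and> (\<forall>x\<in>S. x \<in> T' \<or> - x \<in> T')"
  using assms(2)
proof induction
  case (insert x S)
  then obtain T' where T': "preordering T'" "T \<subseteq> T'" "\<forall>x\<in>S. x \<in> T' \<or> - x \<in> T'" by blast
  obtain T'' where "preordering T''" "T' \<subseteq> T''" "x \<in> T'' \<or> - x \<in> T''"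
    using preordering_extend[OF T'(1), of x] by blast
  with T' show ?case
    by (intro exI[of _ T'']) auto
qed (use assms in blast)

text \<open>These are the elements that are nonnegative for all orderings compatible with the place.\<close>

definition place_cone :: "('k::field \<Rightarrow> real option) \<Rightarrow> 'k set" where
  "place_cone \<zeta> = {a * s\<^sup>2 | a s. \<exists>r. \<zeta> a = Some r \<and> r > 0}"

lemma place_coneI: "\<zeta> a = Some r \<Longrightarrow> r > 0 \<Longrightarrow> a \<in> place_cone \<zeta>"
  unfolding place_cone_def by (intro CollectI exI[of _ a] exI[of _ 1]) simp

text \<open>For sums, factor out the square of larger size, so that the other one is multiplied by a
  finite quotient. If -1 = a s^2, then -a is a square of negative value.\<close>

lemma preordering_place_cone:
  assumes "real_place \<zeta>"
  shows "preordering (place_cone \<zeta>)"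
proof -
  interpret real_place_on \<zeta> by unfold_locales fact
  have coneI: "a * s\<^sup>2 \<in> place_cone \<zeta>" if "\<zeta> a = Some r" "r > 0" for a s r
    using that by (auto simp: place_cone_def)
  have add: "a * s\<^sup>2 + b * t\<^sup>2 \<in> place_cone \<zeta>"
    if a: "\<zeta> a = Some r" "r > 0" and b: "\<zeta> b = Some r'" "r' > 0" and "\<zeta> (t / s) = Some q" "s \<noteq> 0"
    for a b s t r r' q
  proof -
    have "a * s\<^sup>2 + b * t\<^sup>2 = (a + b * (t / s)\<^sup>2) * s\<^sup>2"
      using \<open>s \<noteq> 0\<close> by (simp add: field_simps)
    moreover have "\<zeta> (a + b * (t / s)\<^sup>2) = Some (r + r' * q\<^sup>2)"
      by (intro place_add place_mult place_power that)
    moreover have "r + r' * q\<^sup>2 > 0" using that by (simp add: add_pos_nonneg)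
    ultimately show ?thesis using coneI by metis
  qed
  have "x + y \<in> place_cone \<zeta>" if xy: "x \<in> place_cone \<zeta>" "y \<in> place_cone \<zeta>" for x y
  proof -
    obtain a s r b t r' where x: "x = a * s\<^sup>2" "\<zeta> a = Some r" "r > 0"
      and y: "y = b * t\<^sup>2" "\<zeta> b = Some r'" "r' > 0"
      using xy by (auto simp: place_cone_def)
    consider "s = 0" | "t = 0" | "s \<noteq> 0" "t \<noteq> 0" by blast
    then show ?thesis
    proof cases
      case 3
      then show ?thesis
        using place_ratio[of t s] add[OF x(2,3) y(2,3)] add[OF y(2,3) x(2,3)]
        by (auto simp: x(1) y(1) add.commute)
    qed (use xy x y in auto)
  qed
  moreover have "x * y \<in> place_cone \<zeta>" if xy: "x \<in> place_cone \<zeta>" "y \<in> place_cone \<zeta>" for x y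
  proof -
    obtain a s r b t r' where x: "x = a * s\<^sup>2" "\<zeta> a = Some r" "r > 0"
      and y: "y = b * t\<^sup>2" "\<zeta> b = Some r'" "r' > 0"
      using xy by (auto simp: place_cone_def)
    have eq: "x * y = a * b * (s * t)\<^sup>2" unfolding x y power_mult_distrib by (simp only: mult_ac)
    show ?thesis
      unfolding eq by (rule coneI[OF place_mult[OF x(2) y(2)] mult_pos_pos[OF x(3) y(3)]])
  qed
  moreover have "a\<^sup>2 \<in> place_cone \<zeta>" for a
    using coneI[of 1 1 a] by simp
  moreover have "- 1 \<notin> place_cone \<zeta>"
  proof
    assume "- 1 \<in> place_cone \<zeta>"
    then obtain a s r where as: "- 1 = a * s\<^sup>2" "\<zeta> a = Some r" "r > 0"
      by (auto simp: place_cone_def)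
    then have "s \<noteq> 0" by auto
    have "(inverse s)\<^sup>2 = - (a * s\<^sup>2) * (inverse s)\<^sup>2"
      by (simp flip: as(1))
    also have "\<dots> = - a"
      using \<open>s \<noteq> 0\<close> by (simp add: field_simps)
    finally have "(inverse s)\<^sup>2 = - a" .
    with place_uminus[OF as(2)] place_square_nonneg[of "inverse s"] as(3) show False by simp
  qed
  ultimately show ?thesis by (simp add: preordering_def)
qed

section \<open>Specialising rational functions over a real closed field\<close>

text \<open>Strict positivity in the ordering of a real closed field, whose type carries no order:
  \<open>nz_square (a - b)\<close> reads a > b.\<close>

definition nz_square :: "'k::field \<Rightarrow> bool" where
  "nz_square c \<longleftrightarrow> (\<exists>b. b \<noteq> 0 \<and> c = b\<^sup>2)"

lemma nz_square_neq_0: "nz_square c \<Longrightarrow> c \<noteq> 0"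
  by (auto simp: nz_square_def)

lemma nz_square_square: "b \<noteq> 0 \<Longrightarrow> nz_square (b\<^sup>2)"
  by (auto simp: nz_square_def)

lemma nz_square_mult: "nz_square c \<Longrightarrow> nz_square d \<Longrightarrow> nz_square (c * d)"
  unfolding nz_square_def by (metis mult_eq_0_iff power_mult_distrib)

lemma nz_square_inverse: "nz_square c \<Longrightarrow> nz_square (inverse c)"
  unfolding nz_square_def by (metis inverse_zero_imp_zero power_inverse)

context
  assumes rcf: "real_closed_field TYPE('k::field)"
begin

lemma nz_square_cases: "(c :: 'k) \<noteq> 0 \<Longrightarrow> nz_square c \<or> nz_square (- c)"
  using rcf unfolding real_closed_field_def nz_square_def
  by (metis neg_equal_0_iff_equal zero_power2)

lemma nz_square_add:
  assumes "nz_square (c :: 'k)" "nz_square d" shows "nz_square (c + d)"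
proof (rule ccontr)
  obtain a b where ab: "c = a\<^sup>2" "a \<noteq> 0" "d = b\<^sup>2"
    using assms by (auto simp: nz_square_def)
  have fr: "formally_real TYPE('k)"
    using rcf by (simp add: real_closed_field_def)
  assume "\<not> nz_square (c + d)"
  moreover have "c + d \<noteq> 0"
    using formally_real_sum_squares[OF fr, of a b 0] ab by auto
  ultimately have "nz_square (- (c + d))"
    using nz_square_cases by blast
  then obtain e where "- (c + d) = e\<^sup>2"
    unfolding nz_square_def by blast
  then have "a\<^sup>2 + b\<^sup>2 + e\<^sup>2 = 0"
    unfolding ab by (metis add.right_inverse)
  with formally_real_sum_squares[OF fr] ab show False by blast
qed

lemma nz_square_one: "nz_square (1 :: 'k)"
  unfolding nz_square_def by (rule exI[of _ 1]) simp

lemma nz_square_uminus_minus: "nz_square (a - b) \<Longrightarrow> nz_square (b - (c :: 'k)) \<Longrightarrow> nz_square (a - c)"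
  using nz_square_add[of "a - b" "b - c"] by simp

lemma finite_upper_bound:
  assumes "finite L"
  shows "L = {} \<or> (\<exists>m\<in>L. \<forall>l\<in>L. l = m \<or> nz_square (m - l :: 'k))"
  using assms
proof induction
  case (insert x L)
  show ?case
  proof (cases "L = {}")
    case False
    then obtain m where m: "m \<in> L" "\<forall>l\<in>L. l = m \<or> nz_square (m - l)"
      using insert by blast
    consider "x = m" | "nz_square (m - x)" | "nz_square (x - m)"
      using nz_square_cases[of "m - x"] by fastforce
    then show ?thesis
    proof cases
      case 3
      have "l = x \<or> nz_square (x - l)" if "l \<in> insert x L" for l
        using that m(2) 3 nz_square_uminus_minus[of x m l] by auto
      then show ?thesis by blast
    qed (use m in auto)
  qed simp
qed simp

text \<open>The midpoint of the maximum of L and the minimum of U, or a shift by 1 if one of the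
  sets is empty.\<close>

lemma point_between:
  assumes "finite L" "finite U" "\<And>l u. l \<in> L \<Longrightarrow> u \<in> U \<Longrightarrow> nz_square (u - l :: 'k)"
  shows "\<exists>a. (\<forall>l\<in>L. nz_square (a - l)) \<and> (\<forall>u\<in>U. nz_square (u - a))"
proof -
  have le_add: "nz_square (x - z)" if "nz_square (x - y)" "z = y \<or> nz_square (y - z)" for x y z :: 'k
    using that nz_square_uminus_minus by blast
  have le_add': "nz_square (x - z)" if "x = y \<or> nz_square (x - y)" "nz_square (y - z)" for x y z :: 'k
    using that nz_square_uminus_minus by blast
  have L: "L = {} \<or> (\<exists>m\<in>L. \<forall>l\<in>L. l = m \<or> nz_square (m - l))"
    by (rule finite_upper_bound) fact
  have "uminus ` U = {} \<or> (\<exists>m\<in>uminus ` U. \<forall>l\<in>uminus ` U. l = m \<or> nz_square (m - l))"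
    by (rule finite_upper_bound) (use assms in simp)
  then have U: "U = {} \<or> (\<exists>m\<in>U. \<forall>u\<in>U. u = m \<or> nz_square (u - m))"
    by simp
  show ?thesis
  proof (cases "L = {}")
    case True
    show ?thesis
    proof (cases "U = {}")
      case False
      then obtain m where m: "\<forall>u\<in>U. u = m \<or> nz_square (u - m)" using U by blast
      have "nz_square (u - (m - 1))" if "u \<in> U" for u
        by (rule le_add'[of _ m]) (use m that nz_square_one in auto)
      with True show ?thesis by blast
    qed (use True in simp)
  next
    case False
    then obtain l where l: "l \<in> L" "\<forall>x\<in>L. x = l \<or> nz_square (l - x)" using L by blast
    show ?thesis
    proof (cases "U = {}")
      case True
      have "nz_square (l + 1 - x)" if "x \<in> L" for x
        by (rule le_add[of _ l]) (use l that nz_square_one in auto)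
      with True show ?thesis by blast
    next
      case False
      then obtain u where u: "u \<in> U" "\<forall>x\<in>U. x = u \<or> nz_square (x - u)" using U by blast
      have two: "nz_square (2 :: 'k)"
        using nz_square_add[OF nz_square_one nz_square_one] by simp
      then have "nz_square ((u - l) / 2)"
        unfolding divide_inverse by (intro nz_square_mult nz_square_inverse assms(3) l u)
      moreover have "u - (u + l) / 2 = (u - l) / 2" "(u + l) / 2 - l = (u - l) / 2"
        using nz_square_neq_0[OF two] by (simp_all add: field_simps)
      ultimately have "nz_square (u - (u + l) / 2)" "nz_square ((u + l) / 2 - l)"
        by (simp_all only:)
      then show ?thesis
        using le_add[of "(u + l) / 2" l] le_add'[of _ u "(u + l) / 2"] l u
        by (intro exI[of _ "(u + l) / 2"]) blast
    qed
  qed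
qed

text \<open>Once the preordering decides y - x for all roots x, they fall into those below y and
  those above y. A point a of R in the same gap has the same position relative to every root, so
  each g has the same sign at a as at y. Including Z among the roots keeps a off Z.\<close>

lemma specialise_polys:
  assumes T: "preordering (T :: 'k poly fract set)" and "finite G" "finite Z"
    and G: "\<And>g. g \<in> G \<Longrightarrow> g \<noteq> 0 \<and> Fract g 1 \<in> T"
  shows "\<exists>a. a \<notin> Z \<and> (\<forall>g\<in>G. nz_square (poly g a))"
proof -
  define S where "S = Z \<union> (\<Union>g\<in>G. {x. poly g x = 0})"
  have finS: "finite S"
    using assms poly_roots_finite by (auto simp: S_def)
  define lin where "lin x = Fract [:- x, 1:] 1" for x :: 'k
  have "finite (lin ` S)" using finS by simp
  from preordering_extend_finite[OF T this]
  obtain T' where T': "preordering T'" "T \<subseteq> T'" and dec: "\<forall>x\<in>S. lin x \<in> T' \<or> - lin x \<in> T'"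
    by blast
  have sq: "Fract (p\<^sup>2) 1 \<in> T'" for p :: "'k poly"
    using preordering_square[OF T'(1), of "Fract p 1"] by (simp add: power2_eq_square)
  have const: "Fract [:c:] 1 \<in> T'" if "nz_square c" for c :: 'k
  proof -
    obtain b where "c = b\<^sup>2" using \<open>nz_square c\<close> by (auto simp: nz_square_def)
    then have "[:c:] = [:b:]\<^sup>2" by (simp add: power2_eq_square)
    then show ?thesis using sq by simp
  qed
  have lin_neq_0: "lin x \<noteq> 0" for x
    by (simp add: lin_def Zero_fract_def eq_fract)
  define L where "L = {x\<in>S. lin x \<in> T'}"
  define U where "U = {x\<in>S. - lin x \<in> T'}"
  \<comment> \<open>In the difference of y - l and y - u the variable cancels; what remains is a
    constant, whose sign T' cannot misjudge.\<close>
  have LU: "nz_square (u - l)" if lu: "l \<in> L" "u \<in> U" for l u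
  proof -
    have "lin l + - lin u \<in> T'"
      using lu by (intro preordering_add T') (auto simp: L_def U_def)
    moreover have "lin l + - lin u = Fract [:u - l:] 1"
      by (simp add: lin_def)
    ultimately have ul: "Fract [:u - l:] 1 \<in> T'" by simp
    have "u \<noteq> l"
      using lu preordering_antisym[OF T'(1), of "lin u"] lin_neq_0 by (auto simp: L_def U_def)
    moreover have "\<not> nz_square (l - u)"
    proof
      assume "nz_square (l - u)"
      then have "- Fract [:u - l:] 1 \<in> T'"
        using const[of "l - u"] by simp
      with ul have "Fract [:u - l:] 1 = 0"
        using preordering_antisym T'(1) by blast
      with \<open>u \<noteq> l\<close> show False by (simp add: Zero_fract_def eq_fract)
    qed
    ultimately show ?thesis
      using nz_square_cases[of "u - l"] by simp
  qed
  have fin: "finite L" "finite U"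
    using finS by (simp_all add: L_def U_def)
  obtain a where a: "\<forall>l\<in>L. nz_square (a - l)" "\<forall>u\<in>U. nz_square (u - a)"
    using point_between[OF fin LU] by blast
  have a_S: "a \<notin> S"
  proof
    assume "a \<in> S"
    then have "a \<in> L \<or> a \<in> U" using dec by (auto simp: L_def U_def)
    then show False using a nz_square_neq_0 by force
  qed
  \<comment> \<open>Same sign at y and at a. Unlike positivity alone, this is inherited by products,
    as the induction over factors demands.\<close>
  define signs where "signs g \<longleftrightarrow> Fract g 1 \<in> T' \<and> nz_square (poly g a) \<or> Fract (- g) 1 \<in> T' \<and> nz_square (- poly g a)"
    for g
  have signs: "(\<forall>x. poly g x = 0 \<longrightarrow> x \<in> S) \<longrightarrow> signs g" if "g \<noteq> 0" for g
    using rcf that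
  proof (induction g rule: real_closed_field_poly_induct)
    case (const c)
    then show ?case
      using nz_square_cases[of c] \<open>nz_square c \<Longrightarrow> Fract [:c:] 1 \<in> T'\<close> \<open>nz_square (- c) \<Longrightarrow> Fract [:- c:] 1 \<in> T'\<close>
      by (auto simp: signs_def)
  next
    case (linear x)
    show ?case
    proof
      assume "\<forall>y. poly [:- x, 1:] y = 0 \<longrightarrow> y \<in> S"
      then have "x \<in> S" by simp
      then have "x \<in> L \<or> x \<in> U" using dec by (auto simp: L_def U_def)
      then show "signs [:- x, 1:]"
        using a by (auto simp: signs_def L_def U_def lin_def)
    qed
  next
    case (quadratic x b)
    have "Fract ([:- x, 1:]\<^sup>2 + [:b:]\<^sup>2) 1 \<in> T'"
      using preordering_add[OF T'(1) sq sq, of "[:- x, 1:]" "[:b:]"] by simp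
    moreover have "nz_square (poly ([:- x, 1:]\<^sup>2 + [:b:]\<^sup>2) a)"
    proof (cases "a = x")
      case True
      with quadratic show ?thesis by (simp add: nz_square_square)
    next
      case False
      with quadratic have "nz_square ((a - x)\<^sup>2)" "nz_square (b\<^sup>2)"
        by (simp_all add: nz_square_square)
      from nz_square_add[OF this] show ?thesis by simp
    qed
    ultimately show ?case by (simp add: signs_def)
  next
    case (mult p q)
    show ?case
    proof
      assume "\<forall>x. poly (p * q) x = 0 \<longrightarrow> x \<in> S"
      then have "signs p" "signs q" using mult by auto
      moreover have prod: "Fract (c * d) 1 \<in> T'" if "Fract c 1 \<in> T'" "Fract d 1 \<in> T'" for c d
        using preordering_mult[OF T'(1) that] by simp
      ultimately show "signs (p * q)"
        using prod[of p q] prod[of p "- q"] prod[of "- p" q] prod[of "- p" "- q"]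
          nz_square_mult[of "poly p a" "poly q a"] nz_square_mult[of "poly p a" "- poly q a"]
          nz_square_mult[of "- poly p a" "poly q a"] nz_square_mult[of "- poly p a" "- poly q a"]
        unfolding signs_def by auto
    qed
  qed
  have "nz_square (poly g a)" if "g \<in> G" for g
  proof -
    have "signs g"
      using signs[of g] G[OF that] that by (auto simp: S_def)
    moreover have "Fract (- g) 1 \<notin> T'"
      using preordering_antisym[OF T'(1), of "Fract g 1"] G[OF that] T'(2)
      by (auto simp: Zero_fract_def eq_fract)
    ultimately show ?thesis by (auto simp: signs_def)
  qed
  with a_S show ?thesis by (auto simp: S_def)
qed

end

section \<open>Evaluation of rational functions at a point\<close>

lemma Fract_cancel_root:
  assumes "p \<noteq> 0" "q \<noteq> 0"
  shows "\<exists>p' q'. Fract p q = Fract p' q' \<and> p' \<noteq> 0 \<and> q' \<noteq> 0 \<and> (poly p' (a :: 'k::field) \<noteq> 0 \<or> poly q' a \<noteq> 0)"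
  using assms
proof (induction "degree p" arbitrary: p q rule: less_induct)
  case less
  show ?case
  proof (cases "poly p a = 0 \<and> poly q a = 0")
    case True
    then obtain r s where rs: "p = [:- a, 1:] * r" "q = [:- a, 1:] * s"
      unfolding poly_eq_0_iff_dvd by (elim conjE dvdE)
    with less.prems have "r \<noteq> 0" "s \<noteq> 0" by auto
    then have "degree r < degree p"
      unfolding rs by (subst degree_mult_eq) auto
    moreover have "Fract p q = Fract r s"
      unfolding rs by (rule mult_fract_cancel) simp
    ultimately show ?thesis
      using less.hyps \<open>r \<noteq> 0\<close> \<open>s \<noteq> 0\<close> by metis
  qed (use less.prems in blast)
qed

text \<open>A relation, since only elements of the local ring at y = a have a value, and a given
  numerator and denominator may still share the root a.\<close>

definition fract_value :: "'k::field \<Rightarrow> 'k poly fract \<Rightarrow> 'k \<Rightarrow> bool" where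
  "fract_value a f v \<longleftrightarrow> (\<exists>p q. f = Fract p q \<and> poly q a \<noteq> 0 \<and> v = poly p a / poly q a)"

lemma fract_valueI: "poly q a \<noteq> 0 \<Longrightarrow> fract_value a (Fract p q) (poly p a / poly q a)"
  by (auto simp: fract_value_def)

lemma fract_valueE:
  assumes "fract_value a f v"
  obtains p q where "f = Fract p q" "q \<noteq> 0" "poly q a \<noteq> 0" "v = poly p a / poly q a"
  using assms unfolding fract_value_def by fastforce

lemma fract_value_unique:
  assumes "fract_value a f v" "fract_value a f w" shows "v = w"
proof -
  from assms obtain p q r s where *: "Fract p q = Fract r s" "q \<noteq> 0" "poly q a \<noteq> 0" "s \<noteq> 0" "poly s a \<noteq> 0"
    "v = poly p a / poly q a" "w = poly r a / poly s a"
    by (metis fract_valueE)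
  then have "p * s = r * q" by (simp add: eq_fract)
  then have "poly p a * poly s a = poly r a * poly q a"
    by (metis poly_mult)
  with * show ?thesis by (simp add: frac_eq_eq)
qed

lemma fract_value_add: "fract_value a f v \<Longrightarrow> fract_value a g w \<Longrightarrow> fract_value a (f + g) (v + w)"
  and fract_value_mult: "fract_value a f v \<Longrightarrow> fract_value a g w \<Longrightarrow> fract_value a (f * g) (v * w)"
proof -
  assume "fract_value a f v" "fract_value a g w"
  then obtain p q r s where *: "f = Fract p q" "g = Fract r s" "q \<noteq> 0" "poly q a \<noteq> 0" "s \<noteq> 0" "poly s a \<noteq> 0"
    "v = poly p a / poly q a" "w = poly r a / poly s a"
    by (metis fract_valueE)
  show "fract_value a (f + g) (v + w)"
    using fract_valueI[of "q * s" a "p * s + r * q"] * by (simp add: add_frac_eq mult.commute)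
  show "fract_value a (f * g) (v * w)"
    using fract_valueI[of "q * s" a "p * r"] * by simp
qed

lemma fract_value_const: "fract_value a (Fract [:c:] 1) c"
  using fract_valueI[of 1 a "[:c:]"] by simp

text \<open>Unit, zero or pole at a: the three cases in which the inversion law of a place has to be
  checked for \<open>place_at\<close>.\<close>

lemma fract_value_cases:
  assumes "f \<noteq> 0"
  obtains v where "v \<noteq> 0" "fract_value a f v" "fract_value a (inverse f) (inverse v)"
  | "fract_value a f 0" "\<nexists>v. fract_value a (inverse f) v"
  | "fract_value a (inverse f) 0" "\<nexists>v. fract_value a f v"
proof -
  have no_value: "\<nexists>v. fract_value a (inverse g) v" if "fract_value a g 0" "g \<noteq> 0" for g
  proof
    assume "\<exists>v. fract_value a (inverse g) v"
    then obtain v where "fract_value a (inverse g) v" by blast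
    from fract_value_mult[OF that(1) this] that(2) have "fract_value a 1 0" by simp
    with fract_value_const[of a 1] fract_value_unique[of a 1 0 1] show False
      by (simp add: One_fract_def pCons_one)
  qed
  obtain p q where "f = Fract p q" "p \<noteq> 0" "q \<noteq> 0" "poly p a \<noteq> 0 \<or> poly q a \<noteq> 0"
    using assms Fract_cancel_root by (metis Fract_cases_nonzero)
  note f = this
  show thesis
  proof (cases "poly q a = 0")
    case True
    then have "fract_value a (inverse f) 0"
      using f fract_valueI[of p a q] by simp
    with no_value[of "inverse f"] assms that(3) show thesis by simp
  next
    case q: False
    show thesis
    proof (cases "poly p a = 0")
      case True
      then have "fract_value a f 0"
        using f fract_valueI[of q a p] q by simp
      with no_value[of f] assms that(2) show thesis by simp
    next
      case False
      then show thesis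
        using that(1)[of "poly p a / poly q a"] f q fract_valueI[of q a p] fract_valueI[of p a q] by simp
    qed
  qed
qed

text \<open>The composition of \<open>\<xi>\<close> with the specialisation \<open>y \<mapsto> a\<close>.\<close>

definition place_at :: "('k::field \<Rightarrow> real option) \<Rightarrow> 'k \<Rightarrow> 'k poly fract \<Rightarrow> real option" where
  "place_at \<xi> a f = (if \<exists>v. fract_value a f v then \<xi> (THE v. fract_value a f v) else None)"

lemma place_at_eq: "fract_value a f v \<Longrightarrow> place_at \<xi> a f = \<xi> v"
  unfolding place_at_def using fract_value_unique by (metis (mono_tags, lifting) the_equality)

lemma place_at_SomeE:
  assumes "place_at \<xi> a f = Some r"
  obtains v where "fract_value a f v" "\<xi> v = Some r"
  using assms place_at_eq by (metis option.distinct(1) place_at_def)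

lemma real_place_place_at:
  assumes "real_place \<xi>"
  shows "real_place (place_at \<xi> a)"
proof -
  interpret real_place_on \<xi> by unfold_locales fact
  have one: "place_at \<xi> a 1 = Some 1"
    using place_at_eq[OF fract_value_const[of a 1]] by (simp add: One_fract_def pCons_one)
  have "place_at \<xi> a (f + g) = Some (r + s) \<and> place_at \<xi> a (f * g) = Some (r * s)"
    if fg: "place_at \<xi> a f = Some r" "place_at \<xi> a g = Some s" for f g r s
  proof -
    obtain v w where "fract_value a f v" "\<xi> v = Some r" "fract_value a g w" "\<xi> w = Some s"
      using fg by (metis place_at_SomeE)
    then show ?thesis
      by (simp add: place_at_eq[OF fract_value_add] place_at_eq[OF fract_value_mult] place_add place_mult)
  qed
  moreover have "place_at \<xi> a f = None \<longleftrightarrow> place_at \<xi> a (inverse f) = Some 0" if "f \<noteq> 0" for f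
    using that
  proof (cases rule: fract_value_cases[where a = a])
    case (1 v)
    then show ?thesis
      by (simp add: place_at_eq place_None_iff)
  next
    case 2
    then have "place_at \<xi> a (inverse f) = None" by (simp add: place_at_def)
    with 2 show ?thesis by (simp add: place_at_eq)
  next
    case 3
    then have "place_at \<xi> a f = None" by (simp add: place_at_def)
    with 3 show ?thesis by (simp add: place_at_eq)
  qed
  ultimately show ?thesis
    using one by (simp add: real_place_def)
qed

definition const_fract :: "'k::field \<Rightarrow> 'k poly fract" where
  "const_fract c = Fract [:c:] 1"

lemma field_embedding_const_fract: "field_embedding const_fract"
  by unfold_locales (auto simp: field_hom_def const_fract_def One_fract_def pCons_one mult.commute)

lemma fract_value_of_nat: "fract_value a (of_nat n) (of_nat n)"
  using fract_value_const[of a "of_nat n"] by (simp add: of_nat_fract of_nat_poly)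

section \<open>The topology of the space of real places\<close>

lemma topspace_Mtop [simp]: "topspace Mtop = places"
proof -
  have "Hsub 1 = places"
    by (auto simp: Hsub_def places_iff real_place_on.place_one)
  then have "places \<subseteq> \<Union> (range Hsub)" by blast
  moreover have "\<Union> (range Hsub) \<subseteq> places" by (auto simp: Hsub_def)
  ultimately show ?thesis
    unfolding Mtop_def topology_generated_by_topspace by blast
qed

lemma openin_Hsub: "openin Mtop (Hsub b)"
  by (simp add: Mtop_def topology_generated_by_Basis)

lemma openin_Mtop_basis:
  assumes "openin Mtop U" "\<zeta> \<in> U"
  shows "\<exists>B. finite B \<and> (\<forall>b\<in>B. \<zeta> \<in> Hsub b) \<and> (\<forall>\<zeta>'\<in>places. (\<forall>b\<in>B. \<zeta>' \<in> Hsub b) \<longrightarrow> \<zeta>' \<in> U)"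
proof -
  have "generate_topology_on (range Hsub) U"
    using assms(1) by (simp add: Mtop_def openin_topology_generated_by_iff)
  then show ?thesis
    using assms(2)
  proof induction
    case (Int U V)
    then obtain B C where "finite B" "\<forall>b\<in>B. \<zeta> \<in> Hsub b" "\<forall>\<zeta>'\<in>places. (\<forall>b\<in>B. \<zeta>' \<in> Hsub b) \<longrightarrow> \<zeta>' \<in> U"
      "finite C" "\<forall>b\<in>C. \<zeta> \<in> Hsub b" "\<forall>\<zeta>'\<in>places. (\<forall>b\<in>C. \<zeta>' \<in> Hsub b) \<longrightarrow> \<zeta>' \<in> V"
      by blast
    then show ?case
      by (intro exI[of _ "B \<union> C"]) auto
  next
    case (UN K)
    then show ?case by (meson UnionE UnionI)
  next
    case (Basis S)
    then obtain b where "S = Hsub b" by blast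
    with Basis show ?case by (intro exI[of _ "{b}"]) simp
  qed simp
qed

text \<open>A finite positive value of b means 1/n < b < n for some n, that is, n b - 1 and n - b
  are positive. These sign conditions specialise to some a, where they bound the value of b away
  from 0 and infinity again.\<close>

lemma places_at_points_dense:
  fixes \<zeta> :: "'k::field poly fract \<Rightarrow> real option"
  assumes rcf: "real_closed_field TYPE('k)" and U: "openin Mtop U" "\<zeta> \<in> U" and "finite Z"
  shows "\<exists>a. a \<notin> Z \<and> place_at (\<zeta> \<circ> const_fract) a \<in> U"
proof -
  let ?\<xi> = "\<zeta> \<circ> const_fract"
  obtain B where B: "finite B" "\<And>b. b \<in> B \<Longrightarrow> \<zeta> \<in> Hsub b"
    "\<And>\<zeta>'. \<zeta>' \<in> places \<Longrightarrow> (\<forall>b\<in>B. \<zeta>' \<in> Hsub b) \<Longrightarrow> \<zeta>' \<in> U"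
    using openin_Mtop_basis[OF U] by blast
  have "\<zeta> \<in> places"
    using U openin_subset by fastforce
  then interpret \<zeta>: real_place_on \<zeta> by (simp add: places_iff)
  have \<xi>: "real_place ?\<xi>"
    by (rule field_embedding.real_place_comp[OF field_embedding_const_fract \<zeta>.real_place])
  interpret \<xi>: real_place_on ?\<xi> by unfold_locales (rule \<xi>)
  have cone: "preordering (place_cone \<zeta>)"
    by (rule preordering_place_cone[OF \<zeta>.real_place])
  have "\<exists>n::nat. \<exists>r. \<zeta> b = Some r \<and> 1 < of_nat n * r \<and> r < of_nat n" if b: "b \<in> B" for b
  proof -
    obtain r where r: "\<zeta> b = Some r" "r > 0" using B(2)[OF b] by (auto simp: Hsub_def)
    obtain n :: nat where n: "max r (1 / r) < n" using reals_Archimedean2 by blast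
    then have "1 < of_nat n * r" using r by (simp add: field_simps)
    with n r show ?thesis by auto
  qed
  then obtain n :: "_ \<Rightarrow> nat" where n: "\<And>b. b \<in> B \<Longrightarrow> \<exists>r. \<zeta> b = Some r \<and> 1 < of_nat (n b) * r \<and> r < of_nat (n b)"
    by metis
  define F where "F = (\<lambda>b. of_nat (n b) * b - 1) ` B \<union> (\<lambda>b. of_nat (n b) - b) ` B"
  have F: "f \<in> place_cone \<zeta> \<and> f \<noteq> 0" if "f \<in> F" for f
  proof -
    have "\<exists>r. \<zeta> f = Some r \<and> r > 0"
      using that n unfolding F_def
      by (elim UnE imageE) (force intro!: \<zeta>.place_diff \<zeta>.place_mult)+
    then show ?thesis
      using \<zeta>.place_zero place_coneI by force
  qed
  have "\<exists>p q. f = Fract p q \<and> q \<noteq> 0" for f :: "'k poly fract"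
    by (cases f) auto
  then obtain num den where nd: "\<And>f :: 'k poly fract. f = Fract (num f) (den f)" "\<And>f. den f \<noteq> 0"
    by metis
  \<comment> \<open>f and num f * den f differ by the square of the denominator, hence have the same
    sign.\<close>
  define G where "G = (\<lambda>f. num f * den f) ` F"
  have G: "g \<noteq> 0 \<and> Fract g 1 \<in> place_cone \<zeta>" if g: "g \<in> G" for g
  proof -
    obtain f where f: "f \<in> F" "g = num f * den f" using g by (auto simp: G_def)
    have "f * (Fract (den f) 1)\<^sup>2 = Fract (num f) (den f) * (Fract (den f) 1)\<^sup>2"
      using nd(1)[of f] by simp
    also have "\<dots> = Fract g 1"
      using nd(2)[of f] by (simp add: f(2) power2_eq_square eq_fract)
    finally have eq: "Fract g 1 = f * (Fract (den f) 1)\<^sup>2" by simp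
    have "Fract g 1 \<in> place_cone \<zeta>"
      unfolding eq by (intro preordering_mult[OF cone] preordering_square[OF cone]) (use F f in auto)
    moreover have "num f \<noteq> 0"
      using nd[of f] F[OF f(1)] by (auto simp: fract_collapse)
    ultimately show ?thesis
      using nd(2) f by simp
  qed
  have "finite G" using B(1) by (simp add: G_def F_def)
  from specialise_polys[OF rcf cone this \<open>finite Z\<close> G]
  obtain a where a: "a \<notin> Z" "\<And>g. g \<in> G \<Longrightarrow> nz_square (poly g a)" by blast
  have val: "\<exists>v. fract_value a f v \<and> nz_square v" if "f \<in> F" for f
  proof -
    have sq: "nz_square (poly (num f) a * poly (den f) a)"
      using a(2) that by (auto simp: G_def simp flip: poly_mult)
    then have "poly (den f) a \<noteq> 0" using nz_square_neq_0 by fastforce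
    then have v: "fract_value a f (poly (num f) a / poly (den f) a)"
      using fract_valueI nd(1) by metis
    have "poly (num f) a / poly (den f) a = poly (num f) a * poly (den f) a * inverse ((poly (den f) a)\<^sup>2)"
      using \<open>poly (den f) a \<noteq> 0\<close> by (simp add: power2_eq_square field_simps)
    moreover have "nz_square \<dots>"
      by (intro nz_square_mult[OF sq] nz_square_inverse nz_square_square \<open>poly (den f) a \<noteq> 0\<close>)
    ultimately show ?thesis using v by metis
  qed
  have nonneg: "r \<ge> 0" if "nz_square c" "?\<xi> c = Some r" for c r
    using that \<xi>.place_square_nonneg unfolding nz_square_def by blast
  have "place_at ?\<xi> a \<in> Hsub b" if b: "b \<in> B" for b
  proof -
    let ?n = "n b"
    obtain v where v: "fract_value a (of_nat ?n * b - 1) v" "nz_square v"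
      using val b by (auto simp: F_def)
    obtain w where w: "fract_value a (of_nat ?n - b) w" "nz_square w"
      using val b by (auto simp: F_def)
    \<comment> \<open>b is recovered as n - (n - b), so it has a value at a because n - b has
      one.\<close>
    have "fract_value a (of_nat ?n + const_fract (- 1) * (of_nat ?n - b)) (of_nat ?n + (- 1) * w)"
      unfolding const_fract_def
      by (intro fract_value_add fract_value_mult fract_value_const fract_value_of_nat w)
    moreover have "const_fract (- 1) = - (1 :: 'k poly fract)"
      using field_embedding.hom_uminus[OF field_embedding_const_fract, of 1]
      by (simp add: field_embedding.hom_one[OF field_embedding_const_fract])
    ultimately have u: "fract_value a b (of_nat ?n - w)" (is "fract_value a b ?u") by simp
    have "fract_value a (of_nat ?n * b + const_fract (- 1)) (of_nat ?n * ?u + (- 1))"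
      unfolding const_fract_def
      by (intro fract_value_add fract_value_mult fract_value_const fract_value_of_nat u)
    then have vu: "v = of_nat ?n * ?u - 1"
      using v(1) \<open>const_fract (- 1) = - 1\<close> fract_value_unique by fastforce
    obtain r where r: "?\<xi> ?u = Some r"
    proof (cases "?\<xi> ?u")
      case None
      \<comment> \<open>With u infinite, v w / u^2 = (n - 1/u)(n/u - 1) has value -n, although it is
        a nonzero square.\<close>
      let ?i = "inverse ?u"
      have "?u \<noteq> 0" using None \<xi>.place_zero by (metis option.distinct(1))
      then have "v * w * (?i)\<^sup>2 = (of_nat ?n - ?i) * (of_nat ?n * ?i - 1)"
        unfolding vu by (simp add: field_simps power2_eq_square)
      moreover have "nz_square (v * w * (?i)\<^sup>2)"
        using \<open>?u \<noteq> 0\<close> by (intro nz_square_mult v w nz_square_square) simp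
      moreover have "?\<xi> ((of_nat ?n - ?i) * (of_nat ?n * ?i - 1)) = Some ((of_nat ?n - 0) * (of_nat ?n * 0 - 1))"
        by (intro \<xi>.place_mult \<xi>.place_diff \<xi>.place_of_nat \<xi>.place_one \<xi>.place_inverse_of_None None)
      ultimately have "0 \<le> (real ?n - 0) * (real ?n * 0 - 1)"
        using nonneg by metis
      moreover have "?n > 0" using n[OF b] by (intro gr0I) auto
      ultimately show thesis by simp
    qed
    have "?\<xi> v = Some (of_nat ?n * r - 1)"
      unfolding vu by (intro \<xi>.place_mult \<xi>.place_diff \<xi>.place_of_nat \<xi>.place_one r)
    then have "of_nat ?n * r \<ge> 1" using nonneg[OF v(2)] by fastforce
    then have "r > 0" by (smt (verit) mult_nonneg_nonpos of_nat_0_le_iff)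
    moreover have "place_at ?\<xi> a b = Some r" using place_at_eq[OF u] r by metis
    ultimately show ?thesis
      using real_place_place_at[OF \<xi>] by (auto simp: Hsub_def places_def)
  qed
  with B(3)[of "place_at ?\<xi> a"] real_place_place_at[OF \<xi>] a(1) show ?thesis
    by (auto simp: places_def)
qed

section \<open>Extending embeddings to rational function fields\<close>

lemma (in field_embedding) rf_map_Fract:
  assumes "q \<noteq> 0"
  shows "rf_map h (Fract p q) = Fract (map_poly h p) (map_poly h q)"
  unfolding rf_map_def
proof (rule the_equality)
  fix z assume "\<exists>p' q'. q' \<noteq> 0 \<and> Fract p q = Fract p' q' \<and> z = Fract (map_poly h p') (map_poly h q')"
  then obtain p' q' where "q' \<noteq> 0" "Fract p q = Fract p' q'" and z: "z = Fract (map_poly h p') (map_poly h q')"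
    by blast
  then have "map_poly h p * map_poly h q' = map_poly h p' * map_poly h q"
    using assms by (simp add: eq_fract flip: hom_map_poly_mult)
  then show "z = Fract (map_poly h p) (map_poly h q)"
    using assms \<open>q' \<noteq> 0\<close> by (simp add: z eq_fract)
qed (use assms in blast)

lemma (in field_embedding) field_embedding_rf_map: "field_embedding (rf_map h)"
proof
  have one: "map_poly h 1 = 1"
    by (simp flip: pCons_one)
  have "rf_map h (x + y) = rf_map h x + rf_map h y \<and> rf_map h (x * y) = rf_map h x * rf_map h y" for x y
  proof -
    obtain p q r s where "x = Fract p q" "q \<noteq> 0" "y = Fract r s" "s \<noteq> 0"
      by (metis Fract_cases)
    then show ?thesis by (simp add: rf_map_Fract)
  qed
  moreover have "rf_map h 1 = 1"
    by (simp add: One_fract_def rf_map_Fract one)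
  ultimately show "field_hom (rf_map h)"
    by (simp add: field_hom_def)
qed

lemma (in field_embedding) rf_map_const_fract: "rf_map h (const_fract c) = const_fract (h c)"
  by (simp add: const_fract_def rf_map_Fract flip: pCons_one)

definition lin_fract :: "'k::field \<Rightarrow> 'k poly fract" where
  "lin_fract a = Fract [:- a, 1:] 1"

lemma lin_fract_neq_0: "lin_fract a \<noteq> 0"
  by (simp add: lin_fract_def Zero_fract_def eq_fract)

lemma (in field_embedding) rf_map_lin_fract: "rf_map h (lin_fract a) = lin_fract (h a)"
  by (simp add: lin_fract_def rf_map_Fract flip: pCons_one)

lemma rf_map_comp:
  assumes "field_embedding g" "field_embedding h"
  shows "rf_map (h \<circ> g) x = rf_map h (rf_map g x)"
proof -
  interpret g: field_embedding g by fact
  interpret h: field_embedding h by fact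
  interpret hg: field_embedding "h \<circ> g"
    by unfold_locales (simp add: field_hom_def)
  obtain p q where x: "x = Fract p q" "q \<noteq> 0"
    by (metis Fract_cases)
  have "map_poly (h \<circ> g) p = map_poly h (map_poly g p)" for p
    by (simp add: map_poly_map_poly)
  with x show ?thesis
    by (simp add: hg.rf_map_Fract g.rf_map_Fract h.rf_map_Fract)
qed

lemma (in field_embedding) continuous_map_restrict_place:
  "continuous_map Mtop Mtop (restrict_place h)"
  unfolding Mtop_def[where ?'k = 'k]
proof (rule continuous_on_generated_topo)
  fix U assume "U \<in> range (Hsub :: 'k \<Rightarrow> _)"
  then obtain b where "U = Hsub b" by blast
  then have "restrict_place h -` U \<inter> topspace Mtop = Hsub (h b)"
    using restrict_place_in_places by (auto simp: Hsub_def) (auto simp: restrict_place_def)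
  then show "openin Mtop (restrict_place h -` U \<inter> topspace Mtop)"
    by (simp add: openin_Hsub)
next
  have "Hsub 1 = places"
    by (auto simp: Hsub_def places_iff real_place_on.place_one)
  then show "restrict_place h ` topspace Mtop \<subseteq> \<Union> (range (Hsub :: 'k \<Rightarrow> _))"
    using restrict_place_in_places by fastforce
qed

lemma fract_value_lin_fract: "fract_value a (lin_fract b ^ n * const_fract c) ((a - b) ^ n * c)"
proof -
  have "fract_value a (lin_fract b) (a - b)"
    using fract_valueI[of 1 a "[:- b, 1:]"] by (simp add: lin_fract_def)
  then have "fract_value a (lin_fract b ^ n) ((a - b) ^ n)"
    by (induction n) (use fract_value_of_nat[of a 1] in \<open>auto intro: fract_value_mult\<close>)
  then show ?thesis
    unfolding const_fract_def by (intro fract_value_mult fract_value_const)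
qed

section \<open>Places determined by the powers of a linear polynomial\<close>

text \<open>Taylor expansion at b: every polynomial in y arises as a shifted p, and so becomes a
  polynomial in y - b with constant coefficients.\<close>

lemma Fract_expand_lin_fract:
  "Fract (pcompose p [:- b, 1:]) 1 = poly (map_poly const_fract p) (lin_fract b)"
proof (induction p)
  case 0
  then show ?case by (simp add: Zero_fract_def)
next
  case (pCons a p)
  interpret c: field_embedding const_fract by (rule field_embedding_const_fract)
  have "Fract (pcompose (pCons a p) [:- b, 1:]) 1 = const_fract a + lin_fract b * Fract (pcompose p [:- b, 1:]) 1"
    unfolding const_fract_def lin_fract_def pcompose_pCons by simp
  with pCons show ?case by simp
qed

text \<open>Up to factors that have value 1 at both places, every nonzero rational function is c (y
  - b)^k with k an integer; there the places agree by assumption.\<close>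

lemma places_eq_if_powers_lin_fract:
  fixes \<eta>1 \<eta>2 :: "'k::field poly fract \<Rightarrow> real option"
  assumes places: "real_place \<eta>1" "real_place \<eta>2"
    and const: "\<And>c. \<eta>1 (const_fract c) = \<eta>2 (const_fract c)"
    and powers: "\<And>n c. n > 0 \<Longrightarrow> c \<noteq> 0 \<Longrightarrow>
      \<eta>1 (lin_fract b ^ n * const_fract c) \<in> {None, Some 0} \<and>
      \<eta>2 (lin_fract b ^ n * const_fract c) = \<eta>1 (lin_fract b ^ n * const_fract c)"
  shows "\<eta>1 = \<eta>2"
proof
  interpret p1: real_place_on \<eta>1 by unfold_locales fact
  interpret p2: real_place_on \<eta>2 by unfold_locales fact
  interpret c: field_embedding const_fract by (rule field_embedding_const_fract)
  let ?w = "lin_fract b"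
  define unit where "unit u \<longleftrightarrow> \<eta>1 u = Some 1 \<and> \<eta>2 u = Some 1" for u
  have lead: "\<exists>c n u. c \<noteq> 0 \<and> unit u \<and> poly (map_poly const_fract p) ?w = const_fract c * ?w ^ n * u"
    if "p \<noteq> 0" for p
    using that
  proof (induction p)
    case (pCons a p)
    let ?ev = "poly (map_poly const_fract (pCons a p)) ?w"
    show ?case
    proof (cases "p = 0")
      case True
      with pCons show ?thesis
        by (intro exI[of _ a] exI[of _ 0] exI[of _ 1]) (simp add: unit_def)
    next
      case False
      then obtain c n u where cnu: "c \<noteq> 0" "unit u"
        "poly (map_poly const_fract p) ?w = const_fract c * ?w ^ n * u"
        using pCons.IH by blast
      then have ev: "?ev = const_fract a + const_fract c * ?w ^ Suc n * u"
        by simp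
      show ?thesis
      proof (cases "a = 0")
        case True
        with ev cnu show ?thesis
          by (intro exI[of _ c] exI[of _ "Suc n"] exI[of _ u]) simp
      next
        case a: False
        \<comment> \<open>Horner step: x is the quotient of the two competing terms. Value 0 means
          that the constant a dominates, value infinity that the other term does.\<close>
        define x where "x = ?w ^ Suc n * const_fract (c / a)"
        have x: "x \<noteq> 0" "const_fract c * ?w ^ Suc n = const_fract a * x"
          using a cnu(1) by (simp_all add: x_def lin_fract_neq_0)
        consider "\<eta>1 x = Some 0" "\<eta>2 x = Some 0" | "\<eta>1 x = None" "\<eta>2 x = None"
          using powers[of "Suc n" "c / a"] a cnu(1) by (auto simp: x_def)
        then show ?thesis
        proof cases
          case 1
          have "unit (1 + x * u)"
            using p1.place_add[OF p1.place_one p1.place_mult, OF 1(1)]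
              p2.place_add[OF p2.place_one p2.place_mult, OF 1(2)] cnu(2) by (simp add: unit_def)
          moreover have "?ev = const_fract a * ?w ^ 0 * (1 + x * u)"
            unfolding ev x(2) by (simp add: algebra_simps)
          ultimately show ?thesis using a by blast
        next
          case 2
          have "unit (u + inverse x)"
            using p1.place_add[OF _ p1.place_inverse_of_None, OF _ 2(1)]
              p2.place_add[OF _ p2.place_inverse_of_None, OF _ 2(2)] cnu(2) by (simp add: unit_def)
          moreover have "?ev = const_fract c * ?w ^ Suc n * (u + inverse x)"
            unfolding ev x(2) using x(1) by (simp add: algebra_simps)
          ultimately show ?thesis using cnu(1) by blast
        qed
      qed
    qed
  qed simp
  have lead': "\<exists>c n u. c \<noteq> 0 \<and> unit u \<and> Fract p 1 = const_fract c * ?w ^ n * u" if "p \<noteq> 0" for p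
  proof -
    have "pcompose (pcompose p [:b, 1:]) [:- b, 1:] = p"
      by (simp add: pcompose_pCons flip: pcompose_assoc)
    moreover from this have "pcompose p [:b, 1:] \<noteq> 0" using that by auto
    ultimately show ?thesis
      using lead[of "pcompose p [:b, 1:]"] by (simp flip: Fract_expand_lin_fract)
  qed
  fix f
  show "\<eta>1 f = \<eta>2 f"
  proof (cases "f = 0")
    case False
    then obtain p q where f: "f = Fract p q" "p \<noteq> 0" "q \<noteq> 0"
      by (metis Fract_cases_nonzero)
    obtain c n u where cnu: "c \<noteq> 0" "unit u" "Fract p 1 = const_fract c * ?w ^ n * u"
      using lead' f by blast
    obtain d m v where dmv: "d \<noteq> 0" "unit v" "Fract q 1 = const_fract d * ?w ^ m * v"
      using lead' f by blast
    let ?g = "const_fract (c / d) * (?w ^ n / ?w ^ m)"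
    have "f = Fract p 1 / Fract q 1"
      using f by simp
    also have "\<dots> = ?g * (u / v)"
      unfolding cnu dmv by simp
    finally have "\<eta>1 f = \<eta>1 ?g" "\<eta>2 f = \<eta>2 ?g"
      using p1.place_mult_unit[OF p1.place_divide, of u 1 v 1 ?g]
        p2.place_mult_unit[OF p2.place_divide, of u 1 v 1 ?g] cnu(2) dmv(2)
      by (simp_all add: unit_def option.map_ident)
    moreover have "\<eta>1 ?g = \<eta>2 ?g"
    proof (cases n m rule: linorder_cases)
      case less
      \<comment> \<open>Negative exponents are reduced to positive ones by inversion, which
        exchanges the values 0 and infinity.\<close>
      let ?x = "?w ^ (m - n) * const_fract (d / c)"
      have "?w ^ m = ?w ^ n * ?w ^ (m - n)"
        using less by (simp flip: power_add)
      then have g: "?g = inverse ?x"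
        by (simp add: lin_fract_neq_0)
      have "?x \<noteq> 0" using cnu dmv by (simp add: lin_fract_neq_0)
      then show ?thesis
        unfolding g using powers[of "m - n" "d / c"] less cnu dmv
          p1.place_inverse_of_None[of ?x] p1.place_inverse_of_zero[of ?x]
          p2.place_inverse_of_None[of ?x] p2.place_inverse_of_zero[of ?x]
        by auto
    next
      case equal
      then have "?g = const_fract (c / d)" by (simp add: lin_fract_neq_0)
      then show ?thesis using const by (simp only:)
    next
      case greater
      have "?w ^ n = ?w ^ (n - m) * ?w ^ m"
        using greater by (simp flip: power_add)
      then have "?g = ?w ^ (n - m) * const_fract (c / d)"
        by (simp add: lin_fract_neq_0)
      then show ?thesis using powers[of "n - m" "c / d"] greater cnu dmv by simp
    qed
    ultimately show ?thesis by simp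
  qed simp
qed

section \<open>Continuous sections of the restriction map\<close>

text \<open>What the map from M(R(y)) through M(R'_i(y)) to M(F(y)) retains once the real closure is
  forgotten: continuity, the section property, and a fixed place on the constants of F.\<close>

locale place_section = field_embedding e
  for e :: "'r::field \<Rightarrow> 'f::field" +
  fixes \<xi> :: "'f \<Rightarrow> real option"
    and \<sigma> :: "('r poly fract \<Rightarrow> real option) \<Rightarrow> ('f poly fract \<Rightarrow> real option)"
  assumes rcf: "real_closed_field TYPE('r)"
    and place: "real_place \<xi>"
    and continuous: "continuous_map Mtop Mtop \<sigma>"
    and section_eq: "\<zeta> \<in> places \<Longrightarrow> \<sigma> \<zeta> (rf_map e f) = \<zeta> f"
    and on_const: "\<zeta> \<in> places \<Longrightarrow> \<sigma> \<zeta> (const_fract c) = \<xi> c"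
begin

sublocale rf: field_embedding "rf_map e"
  by (rule field_embedding_rf_map)

sublocale const: field_embedding "const_fract :: 'f \<Rightarrow> 'f poly fract"
  by (rule field_embedding_const_fract)

lemma \<sigma>_place: "\<zeta> \<in> places \<Longrightarrow> real_place_on (\<sigma> \<zeta>)"
  using continuous_map_image_subset_topspace[OF continuous] by (auto simp flip: places_iff)

text \<open>Both prescriptions apply to constants from R, so all places of R(y) agree there, and the
  dense places form a single family indexed by a.\<close>

lemma restrict_const: "\<zeta> \<in> places \<Longrightarrow> \<zeta> \<circ> const_fract = \<xi> \<circ> e"
  using section_eq[of \<zeta> "const_fract c" for c] on_const
  by (auto simp: rf_map_const_fract fun_eq_iff)

lemma place_at_in_places: "place_at (\<xi> \<circ> e) a \<in> places"
  using real_place_place_at[OF real_place_comp[OF place]] by (simp add: places_def)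

text \<open>Two maps at once, so that one and the same a serves in the comparison of two
  sections.\<close>

lemma dense:
  assumes "\<zeta> \<in> places" "\<sigma> \<zeta> \<in> Hsub f" "\<sigma>' \<zeta> \<in> Hsub g" "continuous_map Mtop Mtop \<sigma>'" "finite Z"
  shows "\<exists>a. a \<notin> Z \<and> \<sigma> (place_at (\<xi> \<circ> e) a) \<in> Hsub f \<and> \<sigma>' (place_at (\<xi> \<circ> e) a) \<in> Hsub g"
proof -
  have "openin Mtop {\<zeta> \<in> places. \<sigma> \<zeta> \<in> Hsub f}" "openin Mtop {\<zeta> \<in> places. \<sigma>' \<zeta> \<in> Hsub g}"
    using openin_continuous_map_preimage[OF continuous openin_Hsub[of f]]
      openin_continuous_map_preimage[OF assms(4) openin_Hsub[of g]] by simp_all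
  from openin_Int[OF this]
  have "openin Mtop ({\<zeta> \<in> places. \<sigma> \<zeta> \<in> Hsub f} \<inter> {\<zeta> \<in> places. \<sigma>' \<zeta> \<in> Hsub g})" .
  from places_at_points_dense[OF rcf this _ \<open>finite Z\<close>, of \<zeta>] show ?thesis
    using assms restrict_const[OF assms(1)] by auto
qed

text \<open>Since every \<open>a' \<noteq> a\<close> close to \<open>a\<close> makes \<open>(y - a) / (a' - a)\<close> a unit with value \<open>1\<close>,
  continuity forces \<open>y - a\<close> to lie, at the place \<open>y \<mapsto> a\<close>, below all of the base field
  but above everything in \<open>'f\<close> that is infinitesimal over it.\<close>

lemma power_lin_fract:
  assumes "n > 0" "t \<noteq> 0"
  shows "\<sigma> (place_at (\<xi> \<circ> e) a) (lin_fract (e a) ^ n * const_fract t) =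
    (if \<exists>c. c \<noteq> 0 \<and> \<xi> (e c * t) \<noteq> None then Some 0 else None)"
proof -
  let ?\<zeta> = "place_at (\<xi> \<circ> e)" and ?w = "lin_fract (e a)"
  interpret \<xi>: real_place_on \<xi> by unfold_locales (rule place)
  interpret \<eta>: real_place_on "\<sigma> (?\<zeta> b)" for b
    by (rule \<sigma>_place[OF place_at_in_places])
  \<comment> \<open>For coefficients from R the section property gives the value by substituting y =
    b.\<close>
  have base: "\<sigma> (?\<zeta> b) (?w ^ n * const_fract (e d)) = \<xi> (e ((b - a) ^ n * d))" for b d
  proof -
    have "?w ^ n * const_fract (e d) = rf_map e (lin_fract a ^ n * const_fract d)"
      by (simp add: rf_map_const_fract rf_map_lin_fract)
    then show ?thesis
      using section_eq[OF place_at_in_places] place_at_eq[OF fract_value_lin_fract]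
      by (simp only: o_def)
  qed
  show ?thesis
  proof (cases "\<exists>c. c \<noteq> 0 \<and> \<xi> (e c * t) \<noteq> None")
    case True
    then obtain c r where c: "c \<noteq> 0" "\<xi> (e c * t) = Some r" by auto
    \<comment> \<open>Move c from the power to t: at y = a the first factor has value 0 and the
      second is finite.\<close>
    have "?w ^ n * const_fract t = (?w ^ n * const_fract (e (inverse c))) * const_fract (e c * t)"
      using c(1) by simp
    moreover have "\<sigma> (?\<zeta> a) (?w ^ n * const_fract (e (inverse c))) = Some 0"
      unfolding base using \<open>n > 0\<close> by (simp add: power_0_left)
    moreover have "\<sigma> (?\<zeta> a) (const_fract (e c * t)) = Some r"
      using c(2) by (simp only: on_const[OF place_at_in_places])
    ultimately have "\<sigma> (?\<zeta> a) (?w ^ n * const_fract t) = Some (0 * r)"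
      by (simp only: \<eta>.place_mult)
    with True show ?thesis by simp
  next
    case False
    have "\<sigma> (?\<zeta> a) (?w ^ n * const_fract t) = None"
    proof (rule ccontr)
      assume "\<sigma> (?\<zeta> a) (?w ^ n * const_fract t) \<noteq> None"
      then obtain r where r: "\<sigma> (?\<zeta> a) (?w ^ n * const_fract t) = Some r" by blast
      \<comment> \<open>N only makes \<open>?g\<close> positive at a, hence positive at some nearby
        a' as well. At a' just the finiteness of \<open>?w ^ n * const_fract t\<close> is
        used.\<close>
      obtain N :: nat where N: "r < N" using reals_Archimedean2 by blast
      let ?g = "of_nat N - ?w ^ n * const_fract t"
      have "\<sigma> (?\<zeta> a) ?g = Some (N - r)"
        by (intro \<eta>.place_diff \<eta>.place_of_nat r)
      with N have "\<sigma> (?\<zeta> a) \<in> Hsub ?g"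
        using \<sigma>_place[OF place_at_in_places] by (auto simp: Hsub_def places_iff)
      then obtain a' where a': "a' \<noteq> a" "\<sigma> (?\<zeta> a') \<in> Hsub ?g"
        using dense[OF place_at_in_places _ _ continuous, of a ?g ?g "{a}"] by auto
      then obtain s where "\<sigma> (?\<zeta> a') ?g = Some s" by (auto simp: Hsub_def)
      from \<eta>.place_diff[OF \<eta>.place_of_nat this, of N]
      have s: "\<sigma> (?\<zeta> a') (?w ^ n * const_fract t) = Some (N - s)" by simp
      \<comment> \<open>At a' the power of y - a equals d up to a factor of value 1, so finiteness
        passes to d t with d in R nonzero.\<close>
      define d where "d = (a' - a) ^ n"
      have "d \<noteq> 0" using a' by (simp add: d_def)
      then have one: "\<sigma> (?\<zeta> a') (?w ^ n * const_fract (e (inverse d))) = Some 1"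
        unfolding base by (simp flip: d_def)
      have "const_fract (e d * t) = (?w ^ n * const_fract t) / (?w ^ n * const_fract (e (inverse d)))"
        using \<open>d \<noteq> 0\<close> by (simp add: lin_fract_neq_0 field_simps)
      with \<eta>.place_divide[OF s one] have "\<sigma> (?\<zeta> a') (const_fract (e d * t)) = Some (N - s)"
        by simp
      then have "\<xi> (e d * t) \<noteq> None"
        by (simp only: on_const[OF place_at_in_places]) simp
      with \<open>d \<noteq> 0\<close> False show False by blast
    qed
    with False show ?thesis by simp
  qed
qed

end

text \<open>If the sections differ at a place, some element has values of opposite signs there. Both
  signs persist at a nearby place y = a, where the sections coincide.\<close>

lemma place_section_unique:
  assumes "place_section e \<xi> \<sigma>1" "place_section e \<xi> \<sigma>2" and "\<zeta> \<in> places"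
  shows "\<sigma>1 \<zeta> = \<sigma>2 \<zeta>"
proof (rule ccontr)
  interpret s1: place_section e \<xi> \<sigma>1 by fact
  interpret s2: place_section e \<xi> \<sigma>2 by fact
  interpret p1: real_place_on "\<sigma>1 \<zeta>" using s1.\<sigma>_place assms(3) .
  interpret p2: real_place_on "\<sigma>2 \<zeta>" using s2.\<sigma>_place assms(3) .
  have agree: "\<sigma>1 (place_at (\<xi> \<circ> e) a) = \<sigma>2 (place_at (\<xi> \<circ> e) a)" for a
  proof (rule places_eq_if_powers_lin_fract[where b = "e a"])
    show "real_place (\<sigma>1 (place_at (\<xi> \<circ> e) a))" "real_place (\<sigma>2 (place_at (\<xi> \<circ> e) a))"
      using s1.\<sigma>_place s2.\<sigma>_place s1.place_at_in_places by (simp_all add: real_place_on_def)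
  qed (simp_all add: s1.on_const s2.on_const s1.place_at_in_places s1.power_lin_fract s2.power_lin_fract)
  have no_sep: False if "\<sigma>1 \<zeta> g = Some r" "\<sigma>2 \<zeta> g = Some s" "r * s < 0" for g r s
  proof -
    have no: False if "\<sigma>1 \<zeta> g = Some r" "\<sigma>2 \<zeta> g = Some s" "r > 0" "s < 0" for g r s
    proof -
      have "\<sigma>1 \<zeta> \<in> Hsub g" "\<sigma>2 \<zeta> \<in> Hsub (- g)"
        using that p2.place_uminus[OF that(2)] s1.\<sigma>_place[OF assms(3)] s2.\<sigma>_place[OF assms(3)]
        by (auto simp: Hsub_def places_iff)
      then obtain a where "\<sigma>1 (place_at (\<xi> \<circ> e) a) \<in> Hsub g" "\<sigma>2 (place_at (\<xi> \<circ> e) a) \<in> Hsub (- g)"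
        using s1.dense[OF assms(3) _ _ s2.continuous finite.emptyI] by blast
      then obtain x y where xy: "\<sigma>2 (place_at (\<xi> \<circ> e) a) g = Some x" "x > 0"
        "\<sigma>2 (place_at (\<xi> \<circ> e) a) (- g) = Some y" "y > 0"
        unfolding agree by (auto simp: Hsub_def)
      from real_place_on.place_uminus[OF s2.\<sigma>_place[OF s1.place_at_in_places] xy(1)] xy(3)
      have "y = - x" by (metis option.inject)
      with xy show False by simp
    qed
    from that(3) consider "r > 0" "s < 0" | "r < 0" "s > 0"
      by (auto simp: mult_less_0_iff)
    then show False
      using no[OF that(1,2)] no[OF p1.place_uminus[OF that(1)] p2.place_uminus[OF that(2)]]
      by cases simp_all
  qed
  assume "\<sigma>1 \<zeta> \<noteq> \<sigma>2 \<zeta>"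
  then obtain f where f: "\<sigma>1 \<zeta> f \<noteq> \<sigma>2 \<zeta> f" by blast
  show False
  proof (cases "\<sigma>1 \<zeta> f = None \<or> \<sigma>2 \<zeta> f = None")
    case False
    then obtain r s where rs: "\<sigma>1 \<zeta> f = Some r" "\<sigma>2 \<zeta> f = Some s" "r \<noteq> s" using f by auto
    then have "min r s < max r s" by (simp add: min_def max_def)
    then obtain q where "q \<in> \<rat>" "min r s < q" "q < max r s"
      using Rats_dense_in_real by blast
    then obtain m n :: int where mn: "n > 0" "min r s < m / n" "m / n < max r s"
      by (metis Rats_cases')
    \<comment> \<open>A rational m/n strictly between the two values makes n f - m change
      sign.\<close>
    then have "(of_int n * r - of_int m) * (of_int n * s - of_int m) < (0 :: real)"
      unfolding mult_less_0_iff by (auto simp: field_simps min_def max_def split: if_splits)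
    moreover have "\<sigma>1 \<zeta> (of_int n * f - of_int m) = Some (of_int n * r - of_int m)"
      by (intro p1.place_diff p1.place_mult p1.place_of_int rs)
    moreover have "\<sigma>2 \<zeta> (of_int n * f - of_int m) = Some (of_int n * s - of_int m)"
      by (intro p2.place_diff p2.place_mult p2.place_of_int rs)
    ultimately show False using no_sep by blast
  next
    case True
    \<comment> \<open>To separate an infinite value from a finite r, use (n - f^2) / (1 + f^2): it
      has value -1 in the first case and is positive in the second as soon as n > r^2.\<close>
    have value_None: "\<eta> ((of_nat n - f\<^sup>2) / (1 + f\<^sup>2)) = Some (- 1)"
      if "real_place_on \<eta>" "\<eta> f = None" for \<eta> and n :: nat
    proof -
      interpret real_place_on \<eta> by fact
      let ?i = "inverse f"
      have "f \<noteq> 0" using that by auto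
      then have "of_nat n * ?i\<^sup>2 - 1 = (of_nat n - f\<^sup>2) / f\<^sup>2" "?i\<^sup>2 + 1 = (1 + f\<^sup>2) / f\<^sup>2"
        by (simp_all add: left_diff_distrib distrib_right power_inverse divide_inverse)
      then have "(of_nat n - f\<^sup>2) / (1 + f\<^sup>2) = (of_nat n * ?i\<^sup>2 - 1) / (?i\<^sup>2 + 1)"
        using \<open>f \<noteq> 0\<close> by simp
      moreover have "\<eta> ((of_nat n * ?i\<^sup>2 - 1) / (?i\<^sup>2 + 1)) = Some ((of_nat n * 0\<^sup>2 - 1) / (0\<^sup>2 + 1))"
        by (intro place_divide place_diff place_add place_mult place_power place_of_nat place_one
            place_inverse_of_None that) simp
      ultimately show ?thesis by simp
    qed
    have value_Some: "\<exists>v. \<eta> ((of_nat n - f\<^sup>2) / (1 + f\<^sup>2)) = Some v \<and> v > 0"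
      if "real_place_on \<eta>" "\<eta> f = Some r" "r\<^sup>2 < of_nat n" for \<eta> r and n :: nat
    proof -
      interpret real_place_on \<eta> by fact
      have "1 + r\<^sup>2 > 0" by (simp add: add_pos_nonneg)
      then have "\<eta> ((of_nat n - f\<^sup>2) / (1 + f\<^sup>2)) = Some ((of_nat n - r\<^sup>2) / (1 + r\<^sup>2))"
        by (intro place_divide place_diff place_add place_power place_of_nat place_one that) simp
      with that \<open>1 + r\<^sup>2 > 0\<close> show ?thesis by simp
    qed
    have ro: "real_place_on (\<sigma>1 \<zeta>)" "real_place_on (\<sigma>2 \<zeta>)"
      by unfold_locales
    from True f consider r where "\<sigma>1 \<zeta> f = None" "\<sigma>2 \<zeta> f = Some r"
      | r where "\<sigma>2 \<zeta> f = None" "\<sigma>1 \<zeta> f = Some r"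
      by (cases "\<sigma>1 \<zeta> f"; cases "\<sigma>2 \<zeta> f") auto
    then show False
    proof cases
      case 1
      obtain n :: nat where "r\<^sup>2 < n" using reals_Archimedean2 by blast
      from value_Some[OF ro(2) 1(2) this] obtain v
        where v: "\<sigma>2 \<zeta> ((of_nat n - f\<^sup>2) / (1 + f\<^sup>2)) = Some v" "v > 0" by blast
      from no_sep[OF value_None[OF ro(1) 1(1)] v(1)] v(2) show False by simp
    next
      case 2
      obtain n :: nat where "r\<^sup>2 < n" using reals_Archimedean2 by blast
      from value_Some[OF ro(1) 2(2) this] obtain v
        where v: "\<sigma>1 \<zeta> ((of_nat n - f\<^sup>2) / (1 + f\<^sup>2)) = Some v" "v > 0" by blast
      from no_sep[OF v(1) value_None[OF ro(2) 2(1)]] v(2) show False by simp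
    qed
  qed
qed

section \<open>Real closures and the comparison of the two embeddings\<close>

lemma place_of_real_closure:
  assumes P: "field_ordering P" and cl: "real_closure_of P j" and "real_place \<eta>"
  shows "\<eta> \<circ> j = ordering_place P"
proof (rule place_eq_ordering_place[OF P])
  interpret field_embedding j
    using cl by unfold_locales (simp add: real_closure_of_def)
  interpret real_place_on \<eta> by unfold_locales fact
  show "real_place (\<eta> \<circ> j)" by (rule real_place_comp) fact
  \<comment> \<open>The embedding turns elements of P into squares, on which every place of the real
    closure is nonnegative.\<close>
  fix a r assume "a \<in> P" "(\<eta> \<circ> j) a = Some r"
  then show "r \<ge> 0"
    using cl place_square_nonneg by (auto simp: real_closure_of_def)
qed

lemma place_section_of_real_closure:
  fixes e :: "'r::field \<Rightarrow> 'f::field" and j :: "'f \<Rightarrow> 'a::field"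
  assumes rcf: "real_closed_field TYPE('r)" and e: "field_hom e"
    and P: "field_ordering P" and cl: "real_closure_of P j"
    and cont: "continuous_map Mtop Mtop \<iota>"
    and comp: "\<forall>\<zeta>\<in>places. restrict_place (rf_map (j \<circ> e)) (\<iota> \<zeta>) = \<zeta>"
    and nonempty: "(places :: ('r poly fract \<Rightarrow> real option) set) \<noteq> {}"
  shows "place_section e (ordering_place P) (restrict_place (rf_map j) \<circ> \<iota>)"
proof -
  interpret e: field_embedding e by unfold_locales fact
  interpret j: field_embedding j
    using cl by unfold_locales (simp add: real_closure_of_def)
  interpret rf: field_embedding "rf_map j" by (rule j.field_embedding_rf_map)
  have place: "real_place (\<iota> \<zeta>)" if "\<zeta> \<in> places" for \<zeta>
    using continuous_map_image_subset_topspace[OF cont] that by (auto simp: places_def)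
  have const: "\<iota> \<zeta> (const_fract (j c)) = ordering_place P c" if "\<zeta> \<in> places" for \<zeta> c
  proof -
    have "real_place (\<iota> \<zeta> \<circ> const_fract)"
      by (rule field_embedding.real_place_comp[OF field_embedding_const_fract place[OF that]])
    from place_of_real_closure[OF P cl this] show ?thesis
      by (metis comp_apply)
  qed
  show ?thesis
  proof unfold_locales
    show "real_closed_field TYPE('r)" by fact
    \<comment> \<open>That \<open>ordering_place P\<close> is a place is read off from an actual
      one: take any place of R(y), apply \<open>\<iota>\<close>, and restrict to the constants of
      F.\<close>
    obtain \<zeta> :: "'r poly fract \<Rightarrow> real option" where "\<zeta> \<in> places" using nonempty by blast
    then have "real_place (\<iota> \<zeta> \<circ> const_fract)"
      by (intro field_embedding.real_place_comp[OF field_embedding_const_fract place])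
    from j.real_place_comp[OF this] place_of_real_closure[OF P cl this]
    show "real_place (ordering_place P)" by simp
    show "continuous_map Mtop Mtop (restrict_place (rf_map j) \<circ> \<iota>)"
      by (rule continuous_map_compose[OF cont rf.continuous_map_restrict_place])
  next
    fix \<zeta> :: "'r poly fract \<Rightarrow> real option" and f assume "\<zeta> \<in> places"
    with comp show "(restrict_place (rf_map j) \<circ> \<iota>) \<zeta> (rf_map e f) = \<zeta> f"
      using rf_map_comp[OF e.field_embedding_axioms j.field_embedding_axioms, of f]
      by (metis comp_apply restrict_place_def)
  next
    fix \<zeta> :: "'r poly fract \<Rightarrow> real option" and c assume "\<zeta> \<in> places"
    then show "(restrict_place (rf_map j) \<circ> \<iota>) \<zeta> (const_fract c) = ordering_place P c"
      by (simp add: restrict_place_def j.rf_map_const_fract const)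
  qed
qed

theorem theorem5p2:
  fixes e :: "'r::field \<Rightarrow> 'f::field"
    and P1 P2 :: "'f set"
    and j1 :: "'f \<Rightarrow> 'a::field" and j2 :: "'f \<Rightarrow> 'b::field"
    and \<iota>1 :: "('r poly fract \<Rightarrow> real option) \<Rightarrow> ('a poly fract \<Rightarrow> real option)"
    and \<iota>2 :: "('r poly fract \<Rightarrow> real option) \<Rightarrow> ('b poly fract \<Rightarrow> real option)"
  assumes R_rcf: "real_closed_field TYPE('r)"
    and ext: "field_hom e"
    and F_real: "formally_real TYPE('f)"
    and P1: "field_ordering P1" and P2: "field_ordering P2"
    and same_place: "ordering_place P1 = ordering_place P2"
    and cl1: "real_closure_of P1 j1" and cl2: "real_closure_of P2 j2"
    and cont1: "continuous_map Mtop Mtop \<iota>1" and inj1: "inj_on \<iota>1 places"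
    and comp1: "\<forall>\<zeta>\<in>places. restrict_place (rf_map (j1 \<circ> e)) (\<iota>1 \<zeta>) = \<zeta>"
    and cont2: "continuous_map Mtop Mtop \<iota>2" and inj2: "inj_on \<iota>2 places"
    and comp2: "\<forall>\<zeta>\<in>places. restrict_place (rf_map (j2 \<circ> e)) (\<iota>2 \<zeta>) = \<zeta>"
  shows "\<forall>\<zeta>\<in>places. restrict_place (rf_map j1) (\<iota>1 \<zeta>) = restrict_place (rf_map j2) (\<iota>2 \<zeta>)"
proof
  fix \<zeta> :: "'r poly fract \<Rightarrow> real option" assume \<zeta>: "\<zeta> \<in> places"
  then have nonempty: "(places :: ('r poly fract \<Rightarrow> real option) set) \<noteq> {}" by blast
  from place_section_unique[OF
      place_section_of_real_closure[OF R_rcf ext P1 cl1 cont1 comp1 nonempty]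
      place_section_of_real_closure[OF R_rcf ext P2 cl2 cont2 comp2 nonempty, folded same_place] \<zeta>]
  show "restrict_place (rf_map j1) (\<iota>1 \<zeta>) = restrict_place (rf_map j2) (\<iota>2 \<zeta>)"
    by simp
qed

end
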